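(* Let $f\in\mathbb{Q}[x]$ be a polynomial of degree at least $3$ without multiple roots, let $m\geq 3$ be an odd integer, and let $b,c\in\mathbb{Z}\setminus\{0\}$. Consider the hyperelliptic curves $$C_{1}:\ y^2=f(x),\qquad C_{2}:\ y^2=x^m+b,\qquad C_{3}:\ y^2=x^m+c.$$ Then there exists a rational function $D\in\mathbb{Q}(u,v,w)$ such that the Jacobians of the three curves $$C_1^{D}:\ D\,y^2=f(x),\qquad C_2^{D}:\ y^2=D\,x^m+b,\qquad C_3^{D}:\ y^2=D\,x^m+c$$ (the quadratic twist of $C_1$ by $D$ and the $m$-twists of $C_2,C_3$ by $D$) all have positive rank over the field $\mathbb{Q}(u,v,w)$.
   Context: $u,v,w$ are independent indeterminates. For a curve given by an affine equation over a field $F$, its Jacobian means the Jacobian of the smooth projective model over $F$. "Positive rank over $F$" means the group of $F$-rational points of the Jacobian contains a point of infinite order. The $m$-twist $y^2=Dx^m+b$ of $y^2=x^m+b$ is isomorphic over $F$ to $y^2=x^m+bD^{m-1}$ (via $(x,y)\mapsto(Dx,D^{(m-1)/2}y)$). *)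

theory Defs
  imports
    "HOL-Algebra.Algebra"
    "HOL-Algebra.Algebraic_Closure_Type"
    "HOL-Computational_Algebra.Computational_Algebra"
begin

section \<open>Divisor classes of a one-variable function field\<close>

text \<open>
  \<open>L\<close> is a function field in one variable over the field of constants \<open>K \<subseteq> carrier L\<close>, with \<open>K\<close>
  algebraically closed. The points of the smooth projective model of \<open>L/K\<close> are the
  discrete valuation rings of \<open>L/K\<close>; each is represented by its normalised valuation,
  a function on \<open>L \ {0}\<close> that is made unique by being extensional.
\<close>

definition places :: "('l, 'm) ring_scheme \<Rightarrow> 'l set \<Rightarrow> ('l \<Rightarrow> int) set" where
  "places L K = {v \<in> extensional (carrier L - {\<zero>\<^bsub>L\<^esub>}).
     v ` (carrier L - {\<zero>\<^bsub>L\<^esub>}) = UNIV \<and>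
     (\<forall>a \<in> K - {\<zero>\<^bsub>L\<^esub>}. v a = 0) \<and>
     (\<forall>g \<in> carrier L - {\<zero>\<^bsub>L\<^esub>}. \<forall>h \<in> carrier L - {\<zero>\<^bsub>L\<^esub>}.
        v (g \<otimes>\<^bsub>L\<^esub> h) = v g + v h \<and>
        (g \<oplus>\<^bsub>L\<^esub> h \<noteq> \<zero>\<^bsub>L\<^esub> \<longrightarrow> min (v g) (v h) \<le> v (g \<oplus>\<^bsub>L\<^esub> h)))}"

text \<open>All places have degree one, because \<open>K\<close> is algebraically closed.\<close>

definition divisor_degree :: "('p \<Rightarrow>\<^sub>0 int) \<Rightarrow> int" where
  "divisor_degree c = (\<Sum>v \<in> Poly_Mapping.keys c. Poly_Mapping.lookup c v)"

definition Div0 :: "('l, 'm) ring_scheme \<Rightarrow> 'l set \<Rightarrow> (('l \<Rightarrow> int) \<Rightarrow>\<^sub>0 int) monoid" where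
  "Div0 L K = (free_Abelian_group (places L K))
     \<lparr>carrier := {c \<in> carrier (free_Abelian_group (places L K)). divisor_degree c = 0}\<rparr>"

definition principal_divisors ::
    "('l, 'm) ring_scheme \<Rightarrow> 'l set \<Rightarrow> (('l \<Rightarrow> int) \<Rightarrow>\<^sub>0 int) set" where
  "principal_divisors L K = {c \<in> carrier (free_Abelian_group (places L K)).
     \<exists>h \<in> carrier L - {\<zero>\<^bsub>L\<^esub>}. \<forall>v \<in> places L K. Poly_Mapping.lookup c v = v h}"

definition Pic0 :: "('l, 'm) ring_scheme \<Rightarrow> 'l set \<Rightarrow> (('l \<Rightarrow> int) \<Rightarrow>\<^sub>0 int) set monoid" where
  "Pic0 L K = Div0 L K Mod principal_divisors L K"


section \<open>Plane curves over a field of characteristic zero\<close>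

text \<open>
  A plane curve over \<open>F\<close> is given by a polynomial \<open>P\<close> in \<open>F[x][y]\<close> of positive degree in \<open>y\<close>
  (the outer variable), irreducible over the algebraic closure \<open>\<Omega>\<close> of \<open>F\<close>. The function field of
  the curve over \<open>\<Omega>\<close> is \<open>\<Omega>(x)[y]/(P)\<close>, whose elements are represented by their remainders modulo \<open>P\<close>.
\<close>

definition geom_eqn :: "'a::field_char_0 poly poly \<Rightarrow> 'a alg_closure poly fract poly" where
  "geom_eqn P = map_poly (\<lambda>c. to_fract (map_poly to_ac c)) P"

definition geom_function_field ::
    "'a::field_char_0 poly poly \<Rightarrow> 'a alg_closure poly fract poly ring" where
  "geom_function_field P =
     \<lparr>carrier = {h. degree h < degree (geom_eqn P)},
      monoid.mult = (\<lambda>g h. (g * h) mod geom_eqn P), monoid.one = 1,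
      ring.zero = 0, ring.add = (+)\<rparr>"

definition geom_constants :: "'a::field_char_0 alg_closure poly fract poly set" where
  "geom_constants = range (\<lambda>a. [:to_fract [:a:]:])"

definition absolute_galois :: "('a::field_char_0 alg_closure \<Rightarrow> 'a alg_closure) set" where
  "absolute_galois = {\<sigma>. bij \<sigma> \<and> (\<forall>a b. \<sigma> (a + b) = \<sigma> a + \<sigma> b) \<and>
     (\<forall>a b. \<sigma> (a * b) = \<sigma> a * \<sigma> b) \<and> (\<forall>a. \<sigma> (to_ac a) = to_ac a)}"

text \<open>
  The Galois group acts on \<open>\<Omega>(x)[y]/(P)\<close> through the coefficients in \<open>\<Omega>\<close>, fixing \<open>x\<close> and \<open>y\<close>, and on
  valuations by \<open>(\<sigma>v)(h) = v(\<sigma>\<^sup>-\<^sup>1 h)\<close>.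
\<close>

definition galois_ratfun ::
    "('a::field_char_0 alg_closure \<Rightarrow> 'a alg_closure) \<Rightarrow> 'a alg_closure poly fract \<Rightarrow>
       'a alg_closure poly fract" where
  "galois_ratfun \<sigma> r =
     (case quot_of_fract r of (p, q) \<Rightarrow> Fract (map_poly \<sigma> p) (map_poly \<sigma> q))"

definition galois_fun ::
    "('a::field_char_0 alg_closure \<Rightarrow> 'a alg_closure) \<Rightarrow> 'a alg_closure poly fract poly \<Rightarrow>
       'a alg_closure poly fract poly" where
  "galois_fun \<sigma> h = map_poly (galois_ratfun \<sigma>) h"

definition galois_place ::
    "'a::field_char_0 poly poly \<Rightarrow> ('a alg_closure \<Rightarrow> 'a alg_closure) \<Rightarrow>
       ('a alg_closure poly fract poly \<Rightarrow> int) \<Rightarrow> ('a alg_closure poly fract poly \<Rightarrow> int)" where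
  "galois_place P \<sigma> v =
     restrict (\<lambda>h. v (galois_fun (inv_into UNIV \<sigma>) h)) (carrier (geom_function_field P) - {0})"

definition galois_divisor ::
    "'a::field_char_0 poly poly \<Rightarrow> ('a alg_closure \<Rightarrow> 'a alg_closure) \<Rightarrow>
       (('a alg_closure poly fract poly \<Rightarrow> int) \<Rightarrow>\<^sub>0 int) \<Rightarrow>
       (('a alg_closure poly fract poly \<Rightarrow> int) \<Rightarrow>\<^sub>0 int)" where
  "galois_divisor P \<sigma> = frag_extend (\<lambda>v. frag_of (galois_place P \<sigma> v))"

text \<open>
  With \<open>J\<close> the Jacobian of the smooth projective model, \<open>J(\<Omega>)\<close> is the group of degree zero
  divisor classes over \<open>\<Omega>\<close>, and \<open>J(F)\<close> is its subgroup of Galois-invariant classes. (An invariant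
  class need not contain an invariant divisor if the curve has no \<open>F\<close>-rational point.)
\<close>

definition jacobian_points ::
    "'a::field_char_0 poly poly \<Rightarrow>
       (('a alg_closure poly fract poly \<Rightarrow> int) \<Rightarrow>\<^sub>0 int) set monoid" where
  "jacobian_points P = (Pic0 (geom_function_field P) geom_constants)
     \<lparr>carrier := {\<xi> \<in> carrier (Pic0 (geom_function_field P) geom_constants).
        \<forall>\<sigma> \<in> absolute_galois. galois_divisor P \<sigma> ` \<xi> = \<xi>}\<rparr>"

definition jacobian_positive_rank :: "'a::field_char_0 poly poly \<Rightarrow> bool" where
  "jacobian_positive_rank P \<longleftrightarrow>
     (\<exists>\<xi> \<in> carrier (jacobian_points P).
        \<forall>n::nat. n > 0 \<longrightarrow> \<xi> [^]\<^bsub>jacobian_points P\<^esub> n \<noteq> \<one>\<^bsub>jacobian_points P\<^esub>)"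

text \<open>The equation \<open>d y\<^sup>2 = g(x)\<close>.\<close>

definition hyperelliptic_eqn :: "'a::comm_ring_1 \<Rightarrow> 'a poly \<Rightarrow> 'a poly poly" where
  "hyperelliptic_eqn d g = [:- g, 0, [:d:]:]"

text \<open>The field \<open>\<rat>(u,v,w)\<close>, as the fraction field of \<open>\<rat>[u][v][w]\<close>.\<close>

type_synonym ratfun3 = "rat poly poly poly fract"

end

theory Submission
  imports Defs "Jordan_Normal_Form.Char_Poly"
begin

text \<open>
  Put \<open>k = b - c\<close>, \<open>v = (t + k/t)/2\<close> and \<open>w = (k/t - t)/2\<close> for an indeterminate \<open>t\<close>, so that
  \<open>A = v\<^sup>2 - b = w\<^sup>2 - c\<close>. As \<open>m\<close> is odd, \<open>D = f(t)\<^sup>m A\<^sup>m\<^sup>+\<^sup>1\<close> is \<open>f(t)\<close> times a square and \<open>A\<close> times an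
  \<open>m\<close>-th power, which gives a rational point on each of the three twists. Over the algebraic closure
  each twist becomes a curve \<open>y\<^sup>2 = g(x)\<close> with rational \<open>g\<close>, and the abscissa \<open>\<xi>\<close> of the point \<open>Q\<close> is
  transcendental. If \<open>n(Q - Q')\<close> is principal, where \<open>Q'\<close> is the conjugate of \<open>Q\<close> under the
  hyperelliptic involution, then there are polynomials \<open>p\<close>, \<open>q\<close> of degrees at most \<open>n\<close> and \<open>n - 2\<close>,
  not both zero, such that \<open>p + q \<surd>g\<close> vanishes to order \<open>2n\<close> at \<open>\<xi>\<close>, so a Pade determinant of \<open>\<surd>g\<close>
  at \<open>\<xi>\<close> is zero. Up to nonzero factors this determinant is a rational polynomial in \<open>\<xi>\<close>, and at a
  simple root of \<open>g\<close> it specialises to a Pade determinant of \<open>\<surd>(1 + t)\<close>, which is not zero.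
\<close>

hide_const (open) Polynomials.degree up_ring.monom up_ring.coeff Coset.order module.smult Polynomials.lead_coeff
no_notation vec_index (infixl "$" 100)
notation vec_index (infixl "!\<^sub>v" 100)

section \<open>Pade determinants of square roots\<close>

text \<open>The degree bounds \<open>n\<close> and \<open>n - 2\<close> leave (n + 1) + (n - 1) = 2n
  unknown coefficients against 2n vanishing conditions, so one square determinant decides the
  question for each \<open>n\<close>. The second bound is where degree at least 3 of
  \<open>g\<close>, that is positive genus, enters: it comes from the order at infinity. For the
  series of (1 + t)^(1/2) put 1 + t = s^2. A degenerate pair becomes a polynomial in s of degree at
  most 2n with a zero of order at least 2n at s = 1, hence c (s - 1)^(2n); its odd part is too short
  to contain s^(2n-1), so c = 0. The twisted curves have rational equations only over the closure,
  where the abscissa of the point gets multiplied by a root of \<open>D\<close>. The expansion of y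
  at the point nevertheless begins with a value in the base field, and this makes the divisor class
  Galois invariant. Transcendence of the new abscissa then excludes every \<open>n\<close> at once,
  each determinant being a nonzero rational polynomial in it up to nonzero factors. The choice of v
  and w solves v^2 - w^2 = k through v - w = t, v + w = k/t.\<close>

definition pade_degenerate :: "'a::field fps \<Rightarrow> nat \<Rightarrow> bool" where
  "pade_degenerate S n \<longleftrightarrow> (\<exists>A B. (A \<noteq> 0 \<or> B \<noteq> 0) \<and> degree A \<le> n \<and> (B = 0 \<or> degree B + 2 \<le> n) \<and>
     (\<forall>j<2*n. (fps_of_poly A + fps_of_poly B * S) $ j = 0))"

lemma fps_eq_of_square_eq:
  fixes R S :: "'a::field_char_0 fps"
  assumes "R * R = S * S" "R $ 0 = S $ 0" "S $ 0 \<noteq> 0"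
  shows "R = S"
proof -
  have "(R - S) * (R + S) = 0" using assms(1) by (simp add: algebra_simps)
  moreover have "(R + S) $ 0 \<noteq> 0" using assms(2,3) by simp
  hence "R + S \<noteq> 0" by (metis fps_zero_nth)
  ultimately show ?thesis by simp
qed

lemma fps_binomial_half_square: "fps_binomial (1/2::'a::field_char_0) * fps_binomial (1/2) = 1 + fps_X"
  by (simp add: fps_binomial_add_mult[symmetric] fps_binomial_1)

lemma fps_compose_nth_below:
  fixes Z T :: "'a::idom fps"
  assumes "\<And>j. j < N \<Longrightarrow> Z $ j = 0" "T $ 0 = 0" "j < N"
  shows "(Z oo T) $ j = 0"
proof -
  have "(T ^ i) $ j = 0" if "i > j" for i
    using assms(2) that by (simp add: startsby_zero_power_prefix)
  thus ?thesis using assms by (auto simp: fps_compose_nth intro!: sum.neutral)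
qed

text \<open>The substitution t = (1 + s)^2 - 1 turns the root \<open>?S\<close> into the polynomial
  1 + s. What results has degree at most 2n and order at least 2n at s = 0, so it is a monomial;
  written in 1 + s, the contributions of \<open>A\<close> and \<open>B\<close> are its even and odd
  parts.\<close>

lemma not_pade_degenerate_binomial_half:
  assumes "n > 0"
  shows "\<not> pade_degenerate (fps_binomial (1/2 :: 'a::field_char_0)) n"
proof
  let ?S = "fps_binomial (1/2 :: 'a)"
  assume "pade_degenerate ?S n"
  then obtain A B where AB: "A \<noteq> 0 \<or> B \<noteq> 0" "degree A \<le> n" "B = 0 \<or> degree B + 2 \<le> n"
    and Z: "\<And>j. j < 2*n \<Longrightarrow> (fps_of_poly A + fps_of_poly B * ?S) $ j = 0"
    unfolding pade_degenerate_def by blast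
  \<comment> \<open>The polynomial (1 + s)^2 - 1.\<close>
  define p where "p = [:0, 2, 1::'a:]"
  define T where "T = fps_of_poly p"
  have T0: "T $ 0 = 0" by (simp add: T_def p_def)
  have "?S oo T = 1 + fps_X"
  proof (rule fps_eq_of_square_eq)
    have "(?S oo T) * (?S oo T) = (1 + fps_X) oo T"
      by (simp add: fps_compose_mult_distrib[OF T0, symmetric] fps_binomial_half_square)
    also have "\<dots> = 1 + T" using T0 by (simp add: fps_compose_add_distrib)
    also have "1 + T = (1 + fps_X) * (1 + fps_X)"
      unfolding T_def p_def by (simp add: fps_of_poly_pCons algebra_simps)
    finally show "(?S oo T) * (?S oo T) = (1 + fps_X) * (1 + fps_X)" .
  qed simp_all
  define F where "F = pcompose A p + [:1, 1:] * pcompose B p"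
  have "fps_of_poly F = (fps_of_poly A + fps_of_poly B * ?S) oo T"
  proof -
    have "coeff p 0 = 0" by (simp add: p_def)
    hence "fps_of_poly F = (fps_of_poly A oo T) + (fps_X + 1) * (fps_of_poly B oo T)"
      unfolding F_def fps_of_poly_add fps_of_poly_mult fps_of_poly_linear T_def
      by (simp add: fps_of_poly_pcompose)
    thus ?thesis using T0 \<open>?S oo T = 1 + fps_X\<close>
      by (simp add: fps_compose_add_distrib fps_compose_mult_distrib algebra_simps)
  qed
  hence "fps_of_poly F $ j = 0" if "j < 2*n" for j
    using fps_compose_nth_below[of "2*n", OF Z T0 that] by simp
  hence F0: "coeff F j = 0" if "j < 2*n" for j using that by simp
  have dp: "degree p = 2" by (simp add: p_def)
  have dB: "degree ([:1, 1:] * pcompose B p) \<le> 2*n"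
  proof (cases "B = 0")
    case False
    hence "degree ([:1, 1:] * pcompose B p) \<le> 1 + degree B * 2"
      using degree_mult_le[of "[:1,1:]" "pcompose B p"] by (simp add: degree_pcompose dp)
    thus ?thesis using False AB(3) by simp
  qed simp
  have "degree F \<le> 2*n" unfolding F_def
    using dB AB(2) by (intro degree_add_le) (simp_all add: degree_pcompose dp)
  hence Fm: "F = monom (coeff F (2*n)) (2*n)"
    using F0 by (intro poly_eqI) (metis coeff_eq_0 coeff_monom le_less_trans linorder_neqE_nat)
  define c where "c = coeff F (2*n)"
  define E where "E = pcompose A [:-1, 0, 1:]"
  define O' where "O' = pcompose B [:-1, 0, 1:]"
  have pp: "pcompose p [:-1, 1:] = [:-1, 0, 1:]" by (simp add: p_def pcompose_pCons)
  \<comment> \<open>With s - 1 in place of s, \<open>p\<close> becomes s^2 - 1 and 1 + s becomes s.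
    Both \<open>E\<close> and \<open>O'\<close> are even, so the right-hand side is split by
    parity.\<close>
  have "pcompose F [:-1,1:] = E + [:0,1:] * O'"
    unfolding F_def E_def O'_def
    by (simp add: pcompose_add pcompose_mult pcompose_assoc[symmetric] pp)
  moreover have "pcompose F [:-1,1:] = smult c ([:-1,1:]^(2*n))"
    by (subst Fm) (simp add: c_def monom_altdef pcompose_smult pcompose_hom.hom_power pcompose_pCons)
  ultimately have eq: "smult c ([:-1,1:]^(2*n)) = E + [:0,1:] * O'" by simp
  have evE: "coeff (pcompose q [:-1, 0, 1:]) (2*i+1) = 0" for q :: "'a poly" and i
  proof -
    have "pcompose q [:-1, 0, 1:] = pcompose (pcompose q [:-1,1:]) (monom 1 2)"
      by (simp add: pcompose_assoc[symmetric] pcompose_pCons monom_altdef power2_eq_square)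
    thus ?thesis using coeff_pcompose_monom[of 1 2 "pcompose q [:-1,1:]" i] by simp
  qed
  \<comment> \<open>The coefficient of s^(2n-1) is compared: it is nonzero in (s - 1)^(2n), while s
    times \<open>O'\<close> is zero or of degree at most 2n - 3.\<close>
  obtain k where k: "n = Suc k" using assms by (cases n) auto
  have "coeff O' (2*k) = 0"
  proof (cases "B = 0")
    case False
    have "degree O' = 2 * degree B" by (simp add: O'_def degree_pcompose)
    thus ?thesis using False AB(3) k by (intro coeff_eq_0) simp
  qed (simp add: O'_def)
  hence r0: "coeff (E + [:0,1:] * O') (2*k+1) = 0" using evE[of A k] by (simp add: E_def)
  obtain N where N: "N = 2*n choose (2*k+1)" by blast
  have "N \<noteq> 0" unfolding N binomial_eq_0_iff using k by simp
  have "coeff ([:-1,1::'a:]^(2*n)) (2*k+1) = of_nat N * 1^(2*k+1) * (-1)^(2*n-(2*k+1))"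
    unfolding N using k by (intro coeff_linear_poly_power) simp
  hence l0: "coeff ([:-1,1::'a:]^(2*n)) (2*k+1) \<noteq> 0" using \<open>N \<noteq> 0\<close> by simp
  have "c * coeff ([:-1,1:]^(2*n)) (2*k+1) = 0"
    using arg_cong[OF eq, of "\<lambda>q. coeff q (2*k+1)"] r0 by (simp only: coeff_smult)
  with l0 have "c = 0" by (metis mult_eq_0_iff)
  hence EO: "E + [:0,1:] * O' = 0" using eq by simp
  \<comment> \<open>The even and the odd part of the zero polynomial vanish separately.\<close>
  have "O' = 0"
  proof (rule poly_eqI)
    fix i
    show "coeff O' i = coeff 0 i"
    proof (cases "even i")
      case True
      then obtain l where "i = 2*l" by blast
      thus ?thesis using arg_cong[OF EO, of "\<lambda>q. coeff q (2*l+1)"] evE[of A l] by (simp add: E_def)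
    next
      case False
      then obtain l where "i = 2*l+1" using oddE by blast
      thus ?thesis using evE[of B l] by (simp add: O'_def)
    qed
  qed
  moreover from this have "E = 0" using EO by simp
  ultimately have "A = 0" "B = 0" unfolding E_def O'_def by (auto dest!: pcompose_eq_0)
  thus False using AB by simp
qed

text \<open>Replacing t by t/l in both polynomials keeps their degrees and multiplies the
  coefficient of t^j in the combination by l^(-j); the factor \<kappa> is absorbed into the second
  polynomial.\<close>

lemma pade_degenerate_rescale:
  fixes S :: "'a::field fps"
  assumes "pade_degenerate (Abs_fps (\<lambda>j. \<kappa> * l^j * S $ j)) n" "\<kappa> \<noteq> 0" "l \<noteq> 0"
  shows "pade_degenerate S n"
proof -
  let ?S = "Abs_fps (\<lambda>j. \<kappa> * l^j * S $ j)"
  obtain A B where AB: "A \<noteq> 0 \<or> B \<noteq> 0" "degree A \<le> n" "B = 0 \<or> degree B + 2 \<le> n"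
    and Z: "\<And>j. j < 2*n \<Longrightarrow> (fps_of_poly A + fps_of_poly B * ?S) $ j = 0"
    using assms(1) unfolding pade_degenerate_def by blast
  obtain m where m: "m * l = 1" using left_inverse[OF assms(3)] by blast
  hence "m \<noteq> 0" by auto
  define A' where "A' = pcompose A [:0, m:]"
  define B' where "B' = smult \<kappa> (pcompose B [:0, m:])"
  have d: "degree [:0, m:] = 1" using \<open>m \<noteq> 0\<close> by simp
  have "(fps_of_poly A' + fps_of_poly B' * S) $ j
      = m ^ j * (fps_of_poly A + fps_of_poly B * ?S) $ j" for j
  proof -
    have *: "m ^ j * l ^ (j - i) = m ^ i" if ij: "i \<le> j" for i
    proof -
      obtain r where r: "j = i + r" using le_Suc_ex[OF ij] by blast
      have "m ^ (i + r) * l ^ r = m ^ i * (m * l) ^ r"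
        by (simp only: power_add power_mult_distrib mult.assoc)
      thus ?thesis by (simp add: m r)
    qed
    have "(fps_of_poly B' * S) $ j = (\<Sum>i=0..j. m ^ j * (coeff B i * (\<kappa> * l^(j-i) * S $ (j-i))))"
      unfolding fps_mult_nth B'_def
    proof (intro sum.cong refl)
      fix i assume "i \<in> {0..j}"
      hence E1: "m ^ i = m ^ j * l ^ (j - i)" by (intro *[symmetric]) simp
      have E2: "fps_of_poly (smult \<kappa> (B \<circ>\<^sub>p [:0, m:])) $ i = \<kappa> * (m ^ i * coeff B i)"
        by (simp only: fps_of_poly_nth coeff_smult coeff_pcompose_linear)
      show "fps_of_poly (smult \<kappa> (B \<circ>\<^sub>p [:0, m:])) $ i * S $ (j - i) =
          m ^ j * (coeff B i * (\<kappa> * l ^ (j - i) * S $ (j - i)))"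
        unfolding E2 E1 by (simp only: mult_ac)
    qed
    also have "\<dots> = m ^ j * (fps_of_poly B * ?S) $ j"
      by (simp only: fps_mult_nth sum_distrib_left fps_of_poly_nth Abs_fps_inverse fps_nth_Abs_fps)
    finally show ?thesis by (simp only: fps_add_nth A'_def fps_of_poly_nth coeff_pcompose_linear distrib_left)
  qed
  hence "(fps_of_poly A' + fps_of_poly B' * S) $ j = 0" if "j < 2*n" for j
    using Z[OF that] by (simp only: mult_zero_right)
  moreover have "A' = 0 \<longleftrightarrow> A = 0" "B' = 0 \<longleftrightarrow> B = 0"
    using d assms(2) unfolding A'_def B'_def by (simp_all add: pcompose_eq_0_iff)
  moreover have "degree A' = degree A" "degree B' = degree B"
    using d assms(2) unfolding A'_def B'_def by (simp_all add: degree_pcompose)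
  ultimately show ?thesis unfolding pade_degenerate_def using AB
    by (intro exI[of _ A'] exI[of _ B']) simp
qed

text \<open>The coefficients of \<open>fps_of_poly B * S\<close> in degrees n + 1, ..., 2n - 1, as a
  linear map of the n - 1 coefficients of \<open>B\<close>. Since i < n - 1, the natural subtraction
  never truncates. For n = 1 the matrix is empty and has determinant 1, in accordance with
  \<open>B = 0\<close>.\<close>

definition pade_matrix :: "'a::comm_ring_1 fps \<Rightarrow> nat \<Rightarrow> 'a mat" where
  "pade_matrix S n = mat (n-1) (n-1) (\<lambda>(r,i). S $ (n + 1 + r - i))"

text \<open>The conditions in degrees up to n merely express \<open>A\<close> through
  \<open>B\<close>. The other n - 1 conditions form a square homogeneous system for
  \<open>B\<close>.\<close>

lemma pade_degenerate_iff_det: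
  assumes "n > 0"
  shows "pade_degenerate S n \<longleftrightarrow> det (pade_matrix S n) = 0"
proof -
  let ?M = "pade_matrix S n"
  have M: "?M \<in> carrier_mat (n-1) (n-1)" by (simp add: pade_matrix_def)
  have row: "(?M *\<^sub>v v) !\<^sub>v r = (fps_of_poly B * S) $ (n+1+r)"
    if "v \<in> carrier_vec (n-1)" "r < n-1" "\<And>i. coeff B i = (if i < n-1 then v !\<^sub>v i else 0)" for v r B
  proof -
    have "(?M *\<^sub>v v) !\<^sub>v r = (\<Sum>i=0..<n-1. S $ (n+1+r-i) * v !\<^sub>v i)"
      using that by (simp add: pade_matrix_def scalar_prod_def)
    also have "\<dots> = (\<Sum>i=0..n+1+r. coeff B i * S $ (n+1+r-i))"
      using that(2) by (intro sum.mono_neutral_cong_left) (auto simp: that(3) mult.commute)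
    finally show ?thesis by (simp add: fps_mult_nth)
  qed
  show ?thesis unfolding det_0_iff_vec_prod_zero_field[OF M]
  proof
    assume "pade_degenerate S n"
    then obtain A B where AB: "A \<noteq> 0 \<or> B \<noteq> 0" "degree A \<le> n" "B = 0 \<or> degree B + 2 \<le> n"
      and Z: "\<And>j. j < 2*n \<Longrightarrow> (fps_of_poly A + fps_of_poly B * S) $ j = 0"
      unfolding pade_degenerate_def by blast
    have "B \<noteq> 0"
    proof
      assume "B = 0"
      hence "coeff A j = 0" for j using Z[of j] AB(2) assms
        by (cases "j < 2*n") (auto intro: coeff_eq_0)
      hence "A = 0" by (intro poly_eqI) simp
      thus False using AB(1) \<open>B = 0\<close> by simp
    qed
    hence dB: "degree B < n - 1" using AB(3) by simp
    define v where "v = vec (n-1) (coeff B)"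
    have v: "v \<in> carrier_vec (n-1)" by (simp add: v_def)
    have cB: "coeff B i = (if i < n-1 then v !\<^sub>v i else 0)" for i
      using dB by (auto simp: v_def coeff_eq_0)
    have "v !\<^sub>v degree B \<noteq> 0" using \<open>B \<noteq> 0\<close> dB by (simp add: v_def)
    hence "v \<noteq> 0\<^sub>v (n-1)" using dB by auto
    moreover have "?M *\<^sub>v v = 0\<^sub>v (n-1)"
    proof (rule eq_vecI)
      fix r assume "r < dim_vec (0\<^sub>v (n-1) :: 'a vec)"
      hence r: "r < n - 1" by simp
      have "(?M *\<^sub>v v) !\<^sub>v r = (fps_of_poly B * S) $ (n+1+r)" by (rule row[OF v r cB])
      also have "\<dots> = 0" using Z[of "n+1+r"] r AB(2) by (simp add: coeff_eq_0)
      finally show "(?M *\<^sub>v v) !\<^sub>v r = 0\<^sub>v (n-1) !\<^sub>v r" using r by simp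
    qed (simp add: pade_matrix_def)
    ultimately show "\<exists>v. v \<in> carrier_vec (n-1) \<and> v \<noteq> 0\<^sub>v (n-1) \<and> ?M *\<^sub>v v = 0\<^sub>v (n-1)" using v by blast
  next
    assume "\<exists>v. v \<in> carrier_vec (n-1) \<and> v \<noteq> 0\<^sub>v (n-1) \<and> ?M *\<^sub>v v = 0\<^sub>v (n-1)"
    then obtain v where v: "v \<in> carrier_vec (n-1)" "v \<noteq> 0\<^sub>v (n-1)" "?M *\<^sub>v v = 0\<^sub>v (n-1)" by blast
    define B where "B = (\<Sum>i<n-1. monom (v !\<^sub>v i) i)"
    have cB: "coeff B i = (if i < n-1 then v !\<^sub>v i else 0)" for i
      by (auto simp: B_def coeff_sum if_distrib cong: if_cong)
    have "B \<noteq> 0"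
    proof
      assume "B = 0"
      hence "v !\<^sub>v i = 0" if "i < n-1" for i using cB[of i] that by simp
      hence "v = 0\<^sub>v (n-1)" using v(1) by (intro eq_vecI) auto
      thus False using v(2) by simp
    qed
    hence "coeff B (degree B) \<noteq> 0" by simp
    hence dB: "degree B + 2 \<le> n" using cB[of "degree B"] by (auto split: if_splits)
    define A where "A = - truncate_fps (Suc n) (fps_of_poly B * S)"
    have cA: "coeff A j = (if j \<le> n then - (fps_of_poly B * S) $ j else 0)" for j
      by (auto simp: A_def coeff_truncate_fps)
    have "degree A \<le> n" by (intro degree_le) (simp add: cA)
    moreover have "(fps_of_poly A + fps_of_poly B * S) $ j = 0" if "j < 2*n" for j
    proof (cases "j \<le> n")
      case False
      define r where "r = j - n - 1"
      have r: "r < n - 1" "j = n + 1 + r" using False that by (auto simp: r_def)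
      have "(fps_of_poly B * S) $ j = 0"
        using row[OF v(1) r(1) cB] v(3) r by simp
      thus ?thesis using False by (simp add: cA)
    qed (simp add: cA)
    ultimately show "pade_degenerate S n" unfolding pade_degenerate_def
      using \<open>B \<noteq> 0\<close> dB by blast
  qed
qed


section \<open>Specialising power series with coefficients in Q[u]\<close>

definition map_fps :: "('a::zero \<Rightarrow> 'b::zero) \<Rightarrow> 'a fps \<Rightarrow> 'b fps" where
  "map_fps h f = Abs_fps (\<lambda>n. h (f $ n))"

lemma map_fps_nth [simp]: "map_fps h f $ n = h (f $ n)"
  by (simp add: map_fps_def)

lemma (in comm_ring_hom) map_fps_mult: "map_fps hom (f * g) = map_fps hom f * map_fps hom g"
  by (rule fps_ext) (simp add: fps_mult_nth hom_distribs)

lemma (in comm_ring_hom) det_pade_matrix_map_fps: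
  "det (pade_matrix (map_fps hom R) n) = hom (det (pade_matrix R n))"
proof -
  have "pade_matrix (map_fps hom R) n = map_mat hom (pade_matrix R n)"
    by (rule eq_matI) (auto simp: pade_matrix_def)
  thus ?thesis by (simp add: hom_det)
qed

lemma comm_ring_hom_const_poly: "comm_ring_hom (\<lambda>c::'a::comm_ring_1. [:c:])"
  by unfold_locales (auto simp: pCons_one)

lemma comm_ring_hom_eval_rat_poly:
  "comm_ring_hom (\<lambda>p. poly (map_poly of_rat p) (x :: 'a::field_char_0))"
proof -
  interpret map_poly_comm_ring_hom "of_rat :: rat \<Rightarrow> 'a" ..
  show ?thesis by unfold_locales (simp_all add: hom_distribs)
qed

text \<open>Substituting \<open>W - 1\<close> into the binomial series of exponent 1/2 involves only
  rational denominators, so the coefficients of the root remain polynomials and can be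
  specialised.\<close>

lemma rat_poly_fps_sqrt_exists:
  fixes W :: "rat poly fps"
  assumes "W $ 0 = 1"
  obtains R where "R * R = W" "R $ 0 = 1"
proof -
  interpret C: comm_ring_hom "\<lambda>c::rat. [:c:]" by (rule comm_ring_hom_const_poly)
  define H where "H = map_fps (\<lambda>c. [:c:]) (fps_binomial (1/2 :: rat))"
  have "H * H = map_fps (\<lambda>c. [:c:]) (1 + fps_X :: rat fps)"
    unfolding H_def by (simp add: C.map_fps_mult[symmetric] fps_binomial_half_square)
  also have "\<dots> = 1 + fps_X" by (rule fps_ext) (simp add: fps_eq_iff)
  finally have H: "H * H = 1 + fps_X" .
  have W0: "(W - 1) $ 0 = 0" using assms by simp
  have "(H oo (W - 1)) * (H oo (W - 1)) = (1 + fps_X) oo (W - 1)"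
    by (simp add: fps_compose_mult_distrib[OF W0, symmetric] H)
  also have "\<dots> = W" using W0 by (simp add: fps_compose_add_distrib)
  finally show thesis by (rule that) (simp add: H_def pCons_one)
qed

lemma fps_rescale_mult:
  fixes f g :: "'a::comm_ring_1 fps"
  shows "Abs_fps (\<lambda>j. a * l^j * f $ j) * Abs_fps (\<lambda>j. b * l^j * g $ j)
    = Abs_fps (\<lambda>j. a * b * l^j * (f * g) $ j)"
proof (rule fps_ext)
  fix k
  have "(a * l^i * f $ i) * (b * l^(k-i) * g $ (k-i)) = a * b * l^k * (f $ i * g $ (k-i))" if "i \<le> k" for i
  proof -
    have "l^i * l^(k-i) = l^k" using that by (simp flip: power_add)
    thus ?thesis by (metis (no_types, opaque_lifting) mult.assoc mult.commute)
  qed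
  thus "(Abs_fps (\<lambda>j. a * l^j * f $ j) * Abs_fps (\<lambda>j. b * l^j * g $ j)) $ k
      = Abs_fps (\<lambda>j. a * b * l^j * (f * g) $ j) $ k"
    by (simp add: fps_mult_nth sum_distrib_left)
qed

text \<open>
  With \<open>T\<^sub>k\<close> the \<open>k\<close>-th Taylor coefficient of \<open>g\<close> at the indeterminate \<open>u\<close>, the series \<open>W\<close> below is
  \<open>g(u + g(u) t) / g(u)\<close>. The square root \<open>R\<close> of it has coefficients in \<open>\<rat>[u]\<close>, so the Pade
  determinants of \<open>R\<close> are polynomials in \<open>u\<close>. At a simple root of \<open>g\<close> the series \<open>W\<close> is linear in \<open>t\<close>,
  which shows that these polynomials do not vanish.
\<close>

lemma not_pade_degenerate_sqrt:
  fixes g :: "rat poly" and \<alpha> :: complex and \<xi> \<gamma> e :: "'a::field_char_0" and S :: "'a fps"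
  assumes root: "poly (map_poly of_rat g) \<alpha> = 0" and simple: "poly (pderiv (map_poly of_rat g)) \<alpha> \<noteq> 0"
    and transc: "\<And>p::rat poly. p \<noteq> 0 \<Longrightarrow> poly (map_poly of_rat p) \<xi> \<noteq> 0"
    and "\<gamma> \<noteq> 0" "e \<noteq> 0" "n > 0"
    and S: "S * S = fps_const e * fps_of_poly (pcompose (map_poly of_rat g) [:\<xi>, \<gamma>:])"
  shows "\<not> pade_degenerate S n"
proof -
  define T where "T = coeff (pcompose (map_poly (\<lambda>c. [:c:]) g) [:[:0, 1:], 1:])"
  define W where "W = Abs_fps (\<lambda>k. if k = 0 then 1 else T k * g ^ (k - 1))"
  obtain R where R: "R * R = W" "R $ 0 = 1"
    by (rule rat_poly_fps_sqrt_exists[of W]) (auto simp: W_def)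
  have T: "poly (map_poly of_rat (T k)) x = coeff (pcompose (map_poly of_rat g) [:x, 1:]) k"
    for x :: "'b::field_char_0" and k
  proof -
    interpret h: comm_ring_hom "\<lambda>p. poly (map_poly of_rat p) x" by (rule comm_ring_hom_eval_rat_poly)
    have "poly (map_poly of_rat (T k)) x
        = coeff (map_poly (\<lambda>p. poly (map_poly of_rat p) x) (pcompose (map_poly (\<lambda>c. [:c:]) g) [:[:0, 1:], 1:])) k"
      by (simp add: T_def coeff_map_poly)
    also have "\<dots> = coeff (pcompose (map_poly of_rat g) [:x, 1:]) k"
      by (simp add: h.map_poly_pcompose map_poly_map_poly o_def hom_distribs)
    finally show ?thesis .
  qed
  let ?h\<alpha> = "\<lambda>p. poly (map_poly of_rat p) \<alpha>"
  let ?h = "\<lambda>p. poly (map_poly of_rat p) \<xi>"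
  interpret h\<alpha>: comm_ring_hom ?h\<alpha> by (rule comm_ring_hom_eval_rat_poly)
  interpret h: comm_ring_hom ?h by (rule comm_ring_hom_eval_rat_poly)
  define D where "D = det (pade_matrix R n)"
  have "D \<noteq> 0"
  proof
    assume "D = 0"
    define l where "l = ?h\<alpha> (T 1)"
    have "l = coeff (pderiv (pcompose (map_poly of_rat g) [:\<alpha>, 1:])) 0"
      unfolding l_def T by (simp add: coeff_pderiv)
    also have "\<dots> = poly (pderiv (map_poly of_rat g)) \<alpha>"
      by (simp add: pderiv_pcompose pderiv_pCons)
    finally have "l \<noteq> 0" using simple by simp
    have "map_fps ?h\<alpha> R = Abs_fps (\<lambda>j. 1 * l^j * fps_binomial (1/2) $ j)"
    proof (rule fps_eq_of_square_eq)
      have "map_fps ?h\<alpha> R * map_fps ?h\<alpha> R = map_fps ?h\<alpha> W"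
        by (simp add: h\<alpha>.map_fps_mult[symmetric] R(1))
      \<comment> \<open>At the root \<alpha> the factor g^(k-1) is 0 for k > 1 and
        \<open>0 ^ 0 = 1\<close> for k = 1, so \<open>W\<close> specialises to 1 + l t, where l is
        the derivative of g at \<alpha>.\<close>
      also have "\<dots> = Abs_fps (\<lambda>j. 1 * 1 * l^j * (1 + fps_X) $ j)"
      proof (rule fps_ext)
        fix j
        have "?h\<alpha> (T i * g ^ k) = ?h\<alpha> (T i) * 0 ^ k" for i k
          by (simp only: h\<alpha>.hom_mult h\<alpha>.hom_power root)
        thus "map_fps ?h\<alpha> W $ j = Abs_fps (\<lambda>j. 1 * 1 * l^j * (1 + fps_X) $ j) $ j"
          by (cases j) (simp_all add: W_def l_def power_0_left)
      qed
      finally show "map_fps ?h\<alpha> R * map_fps ?h\<alpha> R = Abs_fps (\<lambda>j. 1 * l^j * fps_binomial (1/2) $ j)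
          * Abs_fps (\<lambda>j. 1 * l^j * fps_binomial (1/2) $ j)"
        unfolding fps_rescale_mult fps_binomial_half_square .
    qed (simp_all add: R(2))
    moreover have "pade_degenerate (map_fps ?h\<alpha> R) n"
      using \<open>D = 0\<close> \<open>n > 0\<close> by (simp add: pade_degenerate_iff_det h\<alpha>.det_pade_matrix_map_fps D_def)
    ultimately have "pade_degenerate (fps_binomial (1/2 :: complex)) n"
      using pade_degenerate_rescale[of 1 l "fps_binomial (1/2)" n] \<open>l \<noteq> 0\<close> by simp
    thus False using not_pade_degenerate_binomial_half[OF \<open>n > 0\<close>] by blast
  qed
  hence nd: "\<not> pade_degenerate (map_fps ?h R) n"
    using \<open>n > 0\<close> transc by (simp add: pade_degenerate_iff_det h.det_pade_matrix_map_fps D_def)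
  have "g \<noteq> 0" using simple by auto
  define c where "c = ?h g"
  have "c \<noteq> 0" using transc \<open>g \<noteq> 0\<close> by (simp add: c_def)
  \<comment> \<open>Here S(t)^2 = e g(\<xi> + \<gamma> t), whereas the specialised root satisfies
    R(t)^2 = g(\<xi> + c t) / c. Hence S(t) = \<kappa> R(l t) with l = \<gamma> / c and \<kappa>^2 =
    e c.\<close>
  define l where "l = \<gamma> / c"
  have pc: "pcompose q [:\<xi>, \<gamma>:] = pcompose (pcompose q [:\<xi>, 1:]) [:0, \<gamma>:]" for q
    by (simp add: pcompose_assoc[symmetric] pcompose_pCons)
  have SS: "(S * S) $ j = e * \<gamma>^j * ?h (T j)" for j
    by (simp add: S T pc coeff_pcompose_linear)
  have T0: "?h (T 0) = c" by (simp add: T c_def)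
  define \<kappa> where "\<kappa> = S $ 0"
  have S0: "\<kappa> * \<kappa> = e * c" using SS[of 0] T0 by (simp add: \<kappa>_def)
  hence "\<kappa> \<noteq> 0" using \<open>c \<noteq> 0\<close> \<open>e \<noteq> 0\<close> by auto
  have S_eq: "S = Abs_fps (\<lambda>j. \<kappa> * l^j * map_fps ?h R $ j)"
  proof (rule fps_eq_of_square_eq)
    have "map_fps ?h R * map_fps ?h R = map_fps ?h W"
      by (simp add: h.map_fps_mult[symmetric] R(1))
    moreover have "S * S = Abs_fps (\<lambda>j. (\<kappa> * \<kappa>) * l^j * map_fps ?h W $ j)"
    proof (rule fps_ext)
      fix j
      show "(S * S) $ j = Abs_fps (\<lambda>j. (\<kappa> * \<kappa>) * l^j * map_fps ?h W $ j) $ j"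
      proof (cases j)
        case 0
        thus ?thesis unfolding S0 SS by (simp add: T0 W_def)
      next
        case (Suc i)
        have "?h (T j * g ^ i) = ?h (T j) * c ^ i" by (simp only: h.hom_mult h.hom_power c_def)
        thus ?thesis using \<open>c \<noteq> 0\<close> unfolding S0 SS
          by (simp add: Suc W_def l_def power_divide)
      qed
    qed
    ultimately show "S * S = Abs_fps (\<lambda>j. \<kappa> * l^j * map_fps ?h R $ j) * Abs_fps (\<lambda>j. \<kappa> * l^j * map_fps ?h R $ j)"
      unfolding fps_rescale_mult by simp
    show "Abs_fps (\<lambda>j. \<kappa> * l^j * map_fps ?h R $ j) $ 0 \<noteq> 0" using \<open>\<kappa> \<noteq> 0\<close>
      by (simp add: R(2))
  qed (simp add: R(2) \<kappa>_def)
  have "l \<noteq> 0" using \<open>\<gamma> \<noteq> 0\<close> \<open>c \<noteq> 0\<close> by (simp add: l_def)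
  show ?thesis
  proof
    assume "pade_degenerate S n"
    hence "pade_degenerate (Abs_fps (\<lambda>j. \<kappa> * l^j * map_fps ?h R $ j)) n" by (simp only: S_eq[symmetric])
    hence "pade_degenerate (map_fps ?h R) n"
      by (rule pade_degenerate_rescale[OF _ \<open>\<kappa> \<noteq> 0\<close> \<open>l \<noteq> 0\<close>])
    with nd show False ..
  qed
qed

section \<open>Places from Laurent series\<close>

definition fract_ext :: "('a::{ring_gcd,idom_divide,semiring_gcd_mult_normalize} \<Rightarrow> 'b::field) \<Rightarrow> 'a fract \<Rightarrow> 'b" where
  "fract_ext j r = (case quot_of_fract r of (p, q) \<Rightarrow> j p / j q)"

lemma fract_ext_Fract:
  assumes "inj_idom_hom j" "q \<noteq> 0"
  shows "fract_ext j (Fract p q) = j p / j q"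
proof -
  interpret inj_idom_hom j by fact
  obtain p' q' where pq: "quot_of_fract (Fract p q) = (p', q')" by (cases "quot_of_fract (Fract p q)")
  have "q' \<noteq> 0" using snd_quot_of_fract_nonzero[of "Fract p q"] pq by simp
  have "Fract p' q' = Fract p q" using Fract_quot_of_fract[of "Fract p q"] pq by simp
  hence "p' * q = p * q'" using \<open>q' \<noteq> 0\<close> assms(2) by (simp add: eq_fract)
  hence "j p' * j q = j p * j q'" by (metis hom_mult)
  moreover have "j q \<noteq> 0" "j q' \<noteq> 0" using \<open>q' \<noteq> 0\<close> assms(2) by simp_all
  ultimately show ?thesis by (simp add: fract_ext_def pq field_simps)
qed

lemma fract_ext_to_fract: "inj_idom_hom j \<Longrightarrow> fract_ext j (to_fract p) = j p"
proof -
  assume j: "inj_idom_hom j"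
  interpret inj_idom_hom j by fact
  show ?thesis using fract_ext_Fract[OF j, of 1 p] by (simp add: to_fract_def)
qed

lemma field_hom_fract_ext:
  assumes "inj_idom_hom j"
  shows "field_hom (fract_ext j)"
proof -
  interpret inj_idom_hom j by fact
  note E = fract_ext_Fract[OF assms]
  show ?thesis
  proof unfold_locales
    show "fract_ext j 0 = 0" using fract_ext_to_fract[OF assms, of 0] by simp
    show "fract_ext j 1 = 1" using fract_ext_to_fract[OF assms, of 1] by simp
    fix x y :: "'a fract"
    obtain a b where x: "x = Fract a b" "b \<noteq> 0" by (cases x)
    obtain c d where y: "y = Fract c d" "d \<noteq> 0" by (cases y)
    have nz: "j b \<noteq> 0" "j d \<noteq> 0" using x y by simp_all
    show "fract_ext j (x + y) = fract_ext j x + fract_ext j y"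
      using x y nz by (simp add: E hom_add hom_mult field_simps)
    show "fract_ext j (x * y) = fract_ext j x * fract_ext j y"
      using x y nz by (simp add: E hom_mult)
  qed
qed

definition fls_eval :: "'a::field fls \<Rightarrow> 'a poly \<Rightarrow> 'a fls" where
  "fls_eval \<xi> p = poly (map_poly fls_const p) \<xi>"

lemma comm_ring_hom_fls_const: "comm_ring_hom (fls_const :: 'a::comm_ring_1 \<Rightarrow> 'a fls)"
  by unfold_locales (auto simp: fls_const_mult_const fls_plus_const)

lemma comm_ring_hom_fls_eval: "comm_ring_hom (fls_eval \<xi>)"
proof -
  interpret c: comm_ring_hom "fls_const :: 'a \<Rightarrow> 'a fls" by (rule comm_ring_hom_fls_const)
  interpret map_poly_comm_ring_hom "fls_const :: 'a \<Rightarrow> 'a fls" ..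
  show ?thesis by unfold_locales (simp_all add: hom_distribs fls_eval_def)
qed

lemma fls_eval_pCons: "fls_eval \<xi> (pCons a p) = fls_const a + \<xi> * fls_eval \<xi> p"
  unfolding fls_eval_def by (subst Polynomial.map_poly_pCons) auto

lemma fls_eval_0 [simp]: "fls_eval \<xi> 0 = 0"
  by (simp add: fls_eval_def)

lemma inj_idom_hom_fls_eval:
  assumes "\<And>p. p \<noteq> 0 \<Longrightarrow> fls_eval \<xi> p \<noteq> 0"
  shows "inj_idom_hom (fls_eval \<xi>)"
proof -
  interpret comm_ring_hom "fls_eval \<xi>" by (rule comm_ring_hom_fls_eval)
  show ?thesis by unfold_locales (use assms in blast)
qed

lemma fls_subdegree_power_field [simp]:
  "fls_subdegree ((f :: 'a::field fls) ^ n) = int n * fls_subdegree f"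
  by (cases "f = 0") (auto simp: power_0_left intro!: fls_pow_subdegree_eqI)

text \<open>\<open>fls_subdegree 0\<close> is 0 and not infinite, so the bound survives total
  cancellation only for nonpositive \<open>k\<close>.\<close>

lemma fls_subdegree_add_ge:
  assumes "k \<le> fls_subdegree f" "k \<le> fls_subdegree g" "k \<le> 0"
  shows "k \<le> fls_subdegree (f + g)"
  using assms fls_plus_subdegree[of f g] by (cases "f + g = 0") auto

lemma fls_subdegree_eval_nonneg:
  assumes "fls_subdegree \<xi> \<ge> 0"
  shows "fls_subdegree (fls_eval \<xi> p) \<ge> 0"
proof (induction p)
  case (pCons a p)
  have "0 \<le> fls_subdegree (\<xi> * fls_eval \<xi> p)"
    using pCons assms by (cases "\<xi> * fls_eval \<xi> p = 0") auto
  thus ?case unfolding fls_eval_pCons by (intro fls_subdegree_add_ge) auto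
qed simp

definition finite_param :: "'a::field \<Rightarrow> nat \<Rightarrow> 'a fls" where
  "finite_param x e = fls_const x + fls_X ^ e"

text \<open>The power of X - x dividing \<open>p\<close> becomes a power of t^e, and the cofactor
  evaluates to a series with nonzero constant term.\<close>

lemma fls_eval_finite_param:
  assumes "e > 0" "p \<noteq> 0"
  shows "fls_eval (finite_param x e) p \<noteq> 0"
    and "fls_subdegree (fls_eval (finite_param x e) p) = int e * int (order x p)"
proof -
  let ?\<xi> = "finite_param x e"
  interpret comm_ring_hom "fls_eval ?\<xi>" by (rule comm_ring_hom_fls_eval)
  obtain q where q: "p = [:-x, 1:] ^ order x p * q" "\<not> [:-x, 1:] dvd q"
    using order_decomp[OF assms(2)] by blast
  have "poly q x \<noteq> 0" using q(2) by (simp add: poly_eq_0_iff_dvd)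
  have "fls_subdegree ?\<xi> \<ge> 0" unfolding finite_param_def by (intro fls_subdegree_add_ge) auto
  have lin: "fls_eval ?\<xi> [:-x, 1:] = fls_X ^ e"
    by (simp add: fls_eval_pCons finite_param_def)
  define q' where "q' = synthetic_div q x"
  have "q = [:poly q x:] + [:-x, 1:] * q'"
    using synthetic_div_correct[of q x] unfolding q'_def
    by (metis add.commute synthetic_div_correct' )
  hence "fls_eval ?\<xi> q = fls_eval ?\<xi> [:poly q x:] + fls_X ^ e * fls_eval ?\<xi> q'"
    by (metis hom_add hom_mult lin)
  hence qe: "fls_eval ?\<xi> q = fls_const (poly q x) + fls_X ^ e * fls_eval ?\<xi> q'"
    by (simp add: fls_eval_pCons)
  have sq: "fls_eval ?\<xi> q \<noteq> 0 \<and> fls_subdegree (fls_eval ?\<xi> q) = 0"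
  proof (cases "fls_eval ?\<xi> q' = 0")
    case False
    have "fls_subdegree (fls_X ^ e * fls_eval ?\<xi> q') > 0"
      using False assms(1) fls_subdegree_eval_nonneg[OF \<open>fls_subdegree ?\<xi> \<ge> 0\<close>, of q'] by simp
    moreover from this have "fls_nth (fls_X ^ e * fls_eval ?\<xi> q') 0 = 0" by simp
    ultimately show ?thesis unfolding qe using \<open>poly q x \<noteq> 0\<close>
      by (subst fls_subdegree_add_eq1) (auto simp: fls_eq_iff intro!: exI[of _ 0])
  qed (use \<open>poly q x \<noteq> 0\<close> in \<open>simp add: qe\<close>)
  have "fls_eval ?\<xi> p = (fls_X ^ e) ^ order x p * fls_eval ?\<xi> q"
    by (subst q(1)) (simp only: hom_mult hom_power lin)
  thus "fls_eval ?\<xi> p \<noteq> 0" "fls_subdegree (fls_eval ?\<xi> p) = int e * int (order x p)"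
    using sq by auto
qed

text \<open>In each Horner step the product with \<xi> has negative order, so adding a constant
  cannot change its leading term.\<close>

lemma fls_eval_pole:
  assumes "fls_subdegree \<xi> < 0" "p \<noteq> 0"
  shows "fls_eval \<xi> p \<noteq> 0 \<and> fls_subdegree (fls_eval \<xi> p) = fls_subdegree \<xi> * int (degree p)"
  using assms(2)
proof (induction p)
  case (pCons a p)
  show ?case
  proof (cases "p = 0")
    case False
    have X0: "\<xi> \<noteq> 0" using assms(1) by auto
    have s: "fls_eval \<xi> p \<noteq> 0" "fls_subdegree (\<xi> * fls_eval \<xi> p) = fls_subdegree \<xi> * int (degree (pCons a p))"
      using pCons(2)[OF False] X0 False by (auto simp: algebra_simps)
    have lt: "fls_subdegree (\<xi> * fls_eval \<xi> p) < 0" unfolding s(2) using assms(1) False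
      by (simp add: mult_neg_pos)
    have "fls_subdegree (fls_const a + \<xi> * fls_eval \<xi> p) = fls_subdegree (\<xi> * fls_eval \<xi> p)"
      using s(1) X0 lt by (intro fls_subdegree_add_eq2) auto
    thus ?thesis using s lt unfolding fls_eval_pCons by (metis fls_zero_subdegree less_irrefl)
  qed (use pCons in \<open>simp add: fls_eval_pCons\<close>)
qed simp

lemma fls_eval_finite_param_1:
  "fls_eval (finite_param x 1) p = fps_to_fls (fps_of_poly (pcompose p [:x, 1:]))"
proof (induction p)
  case (pCons a p)
  show ?case
    unfolding fls_eval_pCons pcompose_pCons fps_of_poly_add fps_of_poly_mult fps_to_fls_plus fls_times_fps_to_fls pCons
    by (simp add: fps_of_poly_const fps_of_poly_linear finite_param_def fls_times_fps_to_fls add.commute)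
qed simp

text \<open>An even power of t splits off, and the remaining unit has a root because its constant
  term has one in the algebraically closed field.\<close>

lemma fls_sqrt_exists:
  fixes F :: "'a::{alg_closed_field,field_char_0} fls"
  assumes "even (fls_subdegree F)" "F \<noteq> 0"
  obtains \<eta> where "\<eta> * \<eta> = F"
proof -
  obtain k where k: "fls_subdegree F = 2 * k" using assms(1) by blast
  define a where "a = fls_base_factor_to_fps F"
  have a0: "a $ 0 \<noteq> 0" using assms(2) by (simp add: a_def)
  obtain c where c: "c ^ 2 = a $ 0" using nth_root_exists[of 2 "a $ 0"] by auto
  define R where "R = fps_radical (\<lambda>_ _. c) 2 a"
  have "R ^ 2 = a" using power_radical[OF a0, of "\<lambda>_ _. c" 1] c
    by (simp add: R_def numeral_2_eq_2)
  have "F = fls_X_intpow (fls_subdegree F) * fps_to_fls a"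
    using fls_conv_base_factor_to_fps_shift_subdegree[of F] unfolding a_def
    by (simp add: fls_shifted_times_simps)
  also have "fps_to_fls a = fps_to_fls R * fps_to_fls R"
    unfolding \<open>R ^ 2 = a\<close>[symmetric] by (simp add: power2_eq_square fls_times_fps_to_fls)
  also have "fls_X_intpow (fls_subdegree F) = (fls_X_intpow k * fls_X_intpow k :: 'a fls)"
    unfolding k by (simp add: fls_X_intpow_times_fls_X_intpow)
  finally show thesis by (intro that[of "fls_X_intpow k * fps_to_fls R"]) (simp add: algebra_simps)
qed


lemma fract_regular_imp_poly:
  fixes r :: "'a::{alg_closed_field,factorial_ring_gcd,semiring_gcd_mult_normalize} poly fract"
  assumes "\<And>x. \<exists>e>0. fls_subdegree (fract_ext (fls_eval (finite_param x e)) r) > - int e"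
  obtains A where "r = to_fract A"
proof (cases "r = 0")
  case False
  obtain p q where pq: "quot_of_fract r = (p, q)" by (cases "quot_of_fract r")
  have q0: "q \<noteq> 0" using snd_quot_of_fract_nonzero[of r] pq by simp
  have r: "r = Fract p q" using Fract_quot_of_fract[of r] pq by simp
  have cop: "coprime p q" using coprime_quot_of_fract[of r] pq by simp
  have p0: "p \<noteq> 0" using False r q0 by (auto simp: Zero_fract_def eq_fract)
  have "poly q x \<noteq> 0" for x
  proof
    assume qx: "poly q x = 0"
    obtain e where e: "e > 0" "fls_subdegree (fract_ext (fls_eval (finite_param x e)) r) > - int e"
      using assms by blast
    have inj: "inj_idom_hom (fls_eval (finite_param x e))"
      by (intro inj_idom_hom_fls_eval fls_eval_finite_param(1) e(1))
    have "poly p x \<noteq> 0"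
    proof
      assume "poly p x = 0"
      hence "[:-x, 1:] dvd p" "[:-x, 1:] dvd q" using qx by (simp_all add: poly_eq_0_iff_dvd)
      hence "is_unit [:-x, 1:]" using cop by (metis coprime_common_divisor)
      thus False by (simp add: is_unit_iff_degree)
    qed
    hence "order x p = 0" by (simp add: order_0I)
    moreover have "order x q > 0" using qx q0 by (simp add: order_root)
    moreover have "fls_subdegree (fract_ext (fls_eval (finite_param x e)) r)
        = int e * int (order x p) - int e * int (order x q)"
      using fls_eval_finite_param[OF e(1) p0, of x] fls_eval_finite_param[OF e(1) q0, of x]
      unfolding r fract_ext_Fract[OF inj q0] by (simp add: fls_divide_subdegree)
    ultimately have "int e * int (order x q) < int e" using e(2) by simp
    thus False using \<open>order x q > 0\<close> e(1) by (simp add: mult_less_cancel_left1)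
  qed
  hence "degree q = 0" by (metis alg_closed_imp_poly_has_root neq0_conv)
  then obtain c where c: "q = [:c:]" "c \<noteq> 0" using q0 by (metis degree_eq_zeroE pCons_0_0)
  have "r = to_fract (smult (inverse c) p)" unfolding r c(1) to_fract_def using c(2)
    by (simp add: eq_fract)
  thus thesis by (rule that)
qed (use that[of 0] in simp)

definition laurent_eval :: "'a::{field,factorial_ring_gcd,semiring_gcd_mult_normalize} fls \<Rightarrow> 'a fls \<Rightarrow> 'a poly fract poly \<Rightarrow> 'a fls" where
  "laurent_eval \<xi> \<eta> h = poly (map_poly (fract_ext (fls_eval \<xi>)) h) \<eta>"

text \<open>The order of vanishing along the embedding of the function field into Laurent series
  with x = \<xi>, y = \<eta>. The restriction produces the extensional representative that
  \<open>places\<close> demands.\<close>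

definition laurent_place :: "'a::field_char_0 poly poly \<Rightarrow> 'a alg_closure fls \<Rightarrow> 'a alg_closure fls \<Rightarrow>
    'a alg_closure poly fract poly \<Rightarrow> int" where
  "laurent_place P \<xi> \<eta> = restrict (\<lambda>h. fls_subdegree (laurent_eval \<xi> \<eta> h)) (carrier (geom_function_field P) - {0})"

lemma linear_poly_exhaust: "degree (h :: 'b::zero poly) < 2 \<Longrightarrow> \<exists>a b. h = [:a, b:]"
  by (cases h rule: pCons_cases) (metis One_nat_def degree_eq_zeroE degree_pCons_eq_if less_2_cases_iff nat.inject pCons_0_0)

section \<open>The function field of the curve and its embeddings into Laurent series\<close>

locale hyperelliptic_curve =
  fixes d :: "'a::field_char_0" and g :: "'a poly"
  assumes d_nonzero: "d \<noteq> 0" and degree_ge_3: "degree g \<ge> 3"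
    and squarefree: "\<And>x. order x (map_poly to_ac g) \<le> 1"
begin

abbreviation "P \<equiv> hyperelliptic_eqn d g"
abbreviation "L \<equiv> geom_function_field P"
definition "G = map_poly to_ac g"
definition "\<delta> = to_ac d"

lemma \<delta>_nonzero [simp]: "\<delta> \<noteq> 0"
  using d_nonzero by (simp add: \<delta>_def)

lemma degree_G: "degree G = degree g"
  unfolding G_def by (rule Polynomial.degree_map_poly) simp

lemma G_nonzero [simp]: "G \<noteq> 0"
  using degree_G degree_ge_3 by auto

lemma geom_eqn_P: "geom_eqn P = [:- to_fract G, 0, to_fract [:\<delta>:]:]"
proof -
  have "map_poly to_ac (- g) = - map_poly to_ac g" by (rule poly_eqI) (simp add: coeff_map_poly)
  thus ?thesis unfolding geom_eqn_def hyperelliptic_eqn_def G_def \<delta>_def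
    by (simp add: Polynomial.map_poly_pCons)
qed

lemma degree_geom_eqn: "degree (geom_eqn P) = 2"
  by (simp add: geom_eqn_P)

lemma L_simps [simp]: "carrier L = {h. degree h < 2}" "\<zero>\<^bsub>L\<^esub> = 0"
  "x \<oplus>\<^bsub>L\<^esub> y = x + y" "x \<otimes>\<^bsub>L\<^esub> y = (x * y) mod geom_eqn P"
  by (simp_all add: geom_function_field_def degree_geom_eqn)

text \<open>At a root of \<open>G\<close>, which is simple, the two sides would have orders of
  different parity. This is the irreducibility of the equation of the curve.\<close>

lemma not_square:
  assumes "to_fract [:\<delta>:] * (a * a) = b * b * to_fract G"
  shows "b = 0"
proof (rule ccontr)
  assume b: "b \<noteq> 0"
  hence a: "a \<noteq> 0" using assms by auto
  obtain p q where pq: "a = Fract p q" "q \<noteq> 0" by (cases a)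
  obtain r s where rs: "b = Fract r s" "s \<noteq> 0" by (cases b)
  have p: "p \<noteq> 0" "r \<noteq> 0" using a b pq rs by (auto simp: Zero_fract_def eq_fract)
  have eq: "[:\<delta>:] * (p * p) * (s * s) = r * r * G * (q * q)"
    using assms pq(2) rs(2) unfolding pq(1) rs(1) to_fract_def by (simp add: eq_fract)
  obtain x where "poly G x = 0" using alg_closed_imp_poly_has_root[of G] degree_G degree_ge_3 by auto
  hence "order x G = 1" using squarefree[of x] by (metis G_def G_nonzero One_nat_def le_Suc_eq le_zero_eq order_root)
  moreover have "order x ([:\<delta>:] * (p * p) * (s * s)) = 2 * order x p + 2 * order x s"
    using p rs(2) by (simp add: order_mult order_smult)
  moreover have "order x (r * r * G * (q * q)) = 2 * order x r + order x G + 2 * order x q"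
    using p pq(2) by (simp add: order_mult)
  ultimately have "2 * order x p + 2 * order x s = 2 * order x r + 1 + 2 * order x q" using eq by simp
  thus False by presburger
qed

end

text \<open>Injectivity of \<open>fls_eval \<xi>\<close> says that \<xi> is transcendental over the
  constants, so x = \<xi> extends to all rational functions of x.\<close>

locale laurent_point = hyperelliptic_curve +
  fixes \<xi> \<eta> :: "'a alg_closure fls"
  assumes inj: "inj_idom_hom (fls_eval \<xi>)" and on_curve: "fls_const \<delta> * (\<eta> * \<eta>) = fls_eval \<xi> G"
begin

abbreviation "at_x \<equiv> fract_ext (fls_eval \<xi>)"
abbreviation "at_xy \<equiv> laurent_eval \<xi> \<eta>"

sublocale x: field_hom at_x by (rule field_hom_fract_ext[OF inj])

lemma at_x_to_fract: "at_x (to_fract p) = fls_eval \<xi> p"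
  by (rule fract_ext_to_fract[OF inj])

sublocale at_xy: comm_ring_hom at_xy
proof -
  interpret map_poly_comm_ring_hom at_x ..
  show "comm_ring_hom at_xy" by unfold_locales (simp_all add: hom_distribs laurent_eval_def)
qed

lemma at_pCons: "at_xy (pCons a h) = at_x a + \<eta> * at_xy h"
  unfolding laurent_eval_def by (subst Polynomial.map_poly_pCons) auto

lemma at_linear: "at_xy [:a, b:] = at_x a + at_x b * \<eta>"
  by (simp add: at_pCons mult.commute)

lemma at_geom_eqn: "at_xy (geom_eqn P) = 0"
proof -
  have "fls_eval \<xi> [:\<delta>:] = fls_const \<delta>" by (simp add: fls_eval_pCons)
  thus ?thesis using on_curve
    by (simp add: geom_eqn_P at_pCons x.hom_uminus at_x_to_fract algebra_simps)
qed

lemma at_mod: "at_xy (h mod geom_eqn P) = at_xy h"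
proof -
  have "at_xy h = at_xy (h div geom_eqn P * geom_eqn P + h mod geom_eqn P)" by simp
  also have "\<dots> = at_xy (h mod geom_eqn P)" by (simp only: at_xy.hom_add at_xy.hom_mult at_geom_eqn) simp
  finally show ?thesis ..
qed

text \<open>A relation a + b \<eta> = 0 gives, after squaring, an identity already in the rational
  functions of x, which \<open>not_square\<close> excludes.\<close>

lemma at_nonzero:
  assumes "h \<in> carrier L - {0}"
  shows "at_xy h \<noteq> 0"
proof
  assume 0: "at_xy h = 0"
  obtain a b where h: "h = [:a, b:]" using assms linear_poly_exhaust[of h] by auto
  have "fls_eval \<xi> [:\<delta>:] = fls_const \<delta>" by (simp add: fls_eval_pCons)
  moreover have "at_x a = - (at_x b * \<eta>)" using 0 unfolding h at_linear by (simp add: eq_neg_iff_add_eq_0)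
  ultimately have "at_x (to_fract [:\<delta>:] * (a * a)) = at_x (b * b * to_fract G)"
    using on_curve by (simp add: x.hom_mult at_x_to_fract algebra_simps)
  hence "b = 0" by (intro not_square) (simp only: x.eq_iff)
  moreover from this have "a = 0" using 0 unfolding h at_linear by simp
  ultimately show False using assms h by simp
qed

lemma mult_mod_in_carrier:
  assumes "f \<in> carrier L - {0}" "h \<in> carrier L - {0}"
  shows "(f * h) mod geom_eqn P \<in> carrier L - {0}"
proof -
  have "at_xy ((f * h) mod geom_eqn P) = at_xy f * at_xy h" by (simp add: at_mod at_xy.hom_mult)
  hence "(f * h) mod geom_eqn P \<noteq> 0" using at_nonzero[OF assms(1)] at_nonzero[OF assms(2)] by auto
  moreover have "degree ((f * h) mod geom_eqn P) < 2"
    using degree_mod_less'[of "geom_eqn P" "f * h"] degree_geom_eqn calculation by fastforce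
  ultimately show ?thesis by simp
qed

lemma exists_at_x_subdegree:
  assumes "fls_subdegree (at_x r) = 1 \<or> fls_subdegree (at_x r) = -1 \<or>
     fls_subdegree (at_x r) = 2 \<or> fls_subdegree (at_x r) = -2"
  shows "\<exists>s. s \<noteq> 0 \<and> fls_subdegree (at_x s) = fls_subdegree (at_x r) * k"
proof -
  have r: "at_x r \<noteq> 0" using assms by auto
  hence "r \<noteq> 0" by auto
  hence "at_x r * at_x (inverse r) = 1" by (simp flip: x.hom_mult)
  hence "fls_subdegree (at_x r) + fls_subdegree (at_x (inverse r)) = 0"
    by (metis fls_one_subdegree fls_subdegree_mult mult_eq_0_iff zero_neq_one)
  hence inv: "fls_subdegree (at_x (inverse r)) = - fls_subdegree (at_x r)" by simp
  show ?thesis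
  proof (cases "k \<ge> 0")
    case True
    thus ?thesis using \<open>r \<noteq> 0\<close> by (intro exI[of _ "r ^ nat k"]) (simp add: x.hom_power mult.commute)
  next
    case False
    thus ?thesis using \<open>r \<noteq> 0\<close> by (intro exI[of _ "inverse r ^ nat (-k)"]) (simp only: x.hom_power fls_subdegree_power_field inv, simp add: mult.commute)
  qed
qed

text \<open>The valuation laws are inherited from the Laurent series; what needs \<open>r\<close> is
  that every integer is a value. The last alternative is the ramified case.\<close>

lemma laurent_place_in_places:
  assumes "fls_subdegree (at_x r) = 1 \<or> fls_subdegree (at_x r) = -1 \<or>
     odd (fls_subdegree \<eta>) \<and> (fls_subdegree (at_x r) = 2 \<or> fls_subdegree (at_x r) = -2)"
  shows "laurent_place P \<xi> \<eta> \<in> places L geom_constants"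
proof -
  have surj: "\<exists>h. h \<in> carrier L - {0} \<and> fls_subdegree (at_xy h) = k" for k
  proof (cases "fls_subdegree (at_x r) = 1 \<or> fls_subdegree (at_x r) = -1 \<or> even k")
    case True
    then obtain k' where "k = fls_subdegree (at_x r) * k'" using assms
      by (metis evenE minus_mult_minus mult_1 mult_minus1)
    then obtain s where "s \<noteq> 0" "fls_subdegree (at_x s) = k"
      using exists_at_x_subdegree[of r k'] assms by auto
    thus ?thesis by (intro exI[of _ "[:s:]"]) (simp add: at_pCons)
  next
    case False
    \<comment> \<open>Powers of \<open>r\<close> reach only the even orders; a factor y, of odd
      order, supplies the odd ones.\<close>
    hence "even (k - fls_subdegree \<eta>)" using assms by simp
    then obtain k' where "k - fls_subdegree \<eta> = fls_subdegree (at_x r) * k'" using assms False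
      by (metis evenE minus_mult_minus)
    then obtain s where s: "s \<noteq> 0" "fls_subdegree (at_x s) = k - fls_subdegree \<eta>"
      using exists_at_x_subdegree[of r k'] assms by auto
    have "\<eta> \<noteq> 0" using assms False by auto
    thus ?thesis using s by (intro exI[of _ "[:0, s:]"]) (simp add: at_linear)
  qed
  have const: "fls_subdegree (at_xy a) = 0" if "a \<in> geom_constants" for a
  proof -
    obtain c where c: "a = [:to_fract [:c:]:]" using \<open>a \<in> geom_constants\<close> by (auto simp: geom_constants_def)
    have "at_xy a = fls_const c" unfolding c by (simp add: at_pCons at_x_to_fract fls_eval_pCons)
    thus ?thesis by simp
  qed
  have const_carrier: "a \<in> carrier L" if "a \<in> geom_constants" for a
    using that by (auto simp: geom_constants_def)
  show ?thesis unfolding places_def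
  proof (intro CollectI conjI ballI impI)
    show "laurent_place P \<xi> \<eta> \<in> extensional (carrier L - {\<zero>\<^bsub>L\<^esub>})" by (simp add: laurent_place_def)
    show "laurent_place P \<xi> \<eta> ` (carrier L - {\<zero>\<^bsub>L\<^esub>}) = UNIV"
    proof -
      have "k \<in> laurent_place P \<xi> \<eta> ` (carrier L - {\<zero>\<^bsub>L\<^esub>})" for k
      proof -
        obtain h where "h \<in> carrier L - {0}" "fls_subdegree (at_xy h) = k" using surj by blast
        thus ?thesis by (intro image_eqI[of _ _ h]) (auto simp: laurent_place_def)
      qed
      thus ?thesis by blast
    qed
    show "laurent_place P \<xi> \<eta> a = 0" if "a \<in> geom_constants - {\<zero>\<^bsub>L\<^esub>}" for a
      using that const[of a] const_carrier[of a] by (simp add: laurent_place_def)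
    fix f h assume fh: "f \<in> carrier L - {\<zero>\<^bsub>L\<^esub>}" "h \<in> carrier L - {\<zero>\<^bsub>L\<^esub>}"
    have nz: "at_xy f \<noteq> 0" "at_xy h \<noteq> 0" using fh at_nonzero by simp_all
    show "laurent_place P \<xi> \<eta> (f \<otimes>\<^bsub>L\<^esub> h) = laurent_place P \<xi> \<eta> f + laurent_place P \<xi> \<eta> h"
      using mult_mod_in_carrier[of f h] fh nz by (simp add: laurent_place_def at_mod at_xy.hom_mult)
    assume s: "f \<oplus>\<^bsub>L\<^esub> h \<noteq> \<zero>\<^bsub>L\<^esub>"
    have "f + h \<in> carrier L - {0}" using fh s by (simp add: degree_add_less)
    moreover from this have "at_xy (f + h) \<noteq> 0" by (rule at_nonzero)
    ultimately show "min (laurent_place P \<xi> \<eta> f) (laurent_place P \<xi> \<eta> h) \<le> laurent_place P \<xi> \<eta> (f \<oplus>\<^bsub>L\<^esub> h)"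
      using fh fls_plus_subdegree[of "at_xy f" "at_xy h"] by (simp add: laurent_place_def at_xy.hom_add)
  qed
qed

end

section \<open>Pairs of conjugate places above every point of the projective line\<close>

context hyperelliptic_curve begin

lemma laurent_point_uminus: "laurent_point d g \<xi> \<eta> \<Longrightarrow> laurent_point d g \<xi> (- \<eta>)"
  by (simp add: laurent_point_def laurent_point_axioms_def)

lemma exists_sqrt_over:
  assumes inj: "inj_idom_hom (fls_eval \<xi>)" and "even (fls_subdegree (fls_eval \<xi> G))"
  obtains \<eta> where "laurent_point d g \<xi> \<eta>" "2 * fls_subdegree \<eta> = fls_subdegree (fls_eval \<xi> G)"
proof -
  interpret inj_idom_hom "fls_eval \<xi>" by fact
  define F where "F = fls_const (inverse \<delta>) * fls_eval \<xi> G"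
  have F: "F \<noteq> 0" "fls_subdegree F = fls_subdegree (fls_eval \<xi> G)" by (simp_all add: F_def)
  obtain \<eta> where \<eta>: "\<eta> * \<eta> = F" using fls_sqrt_exists[of F] F assms(2) by metis
  hence "\<eta> \<noteq> 0" using F by auto
  hence "2 * fls_subdegree \<eta> = fls_subdegree F" unfolding \<eta>[symmetric] by simp
  moreover have "fls_const \<delta> * F = fls_eval \<xi> G"
    by (simp add: F_def mult.assoc[symmetric])
  hence "laurent_point d g \<xi> \<eta>" using \<eta> inj by unfold_locales simp_all
  ultimately show thesis using F by (intro that[of \<eta>]) simp_all
qed

text \<open>Up to the factor 1/2, a and b \<eta> are the sum and the difference of the values of the
  function at the two conjugate points.\<close>

lemma laurent_point_bounds:
  assumes "laurent_point d g \<xi> \<eta>" "k \<le> 0"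
    and "k \<le> fls_subdegree (laurent_eval \<xi> \<eta> [:a, b:])" "k \<le> fls_subdegree (laurent_eval \<xi> (- \<eta>) [:a, b:])"
  shows "k \<le> fls_subdegree (fract_ext (fls_eval \<xi>) a)"
    and "k \<le> fls_subdegree (fract_ext (fls_eval \<xi>) b * \<eta>)"
proof -
  interpret p: laurent_point d g \<xi> \<eta> by fact
  interpret m: laurent_point d g \<xi> "- \<eta>" by (rule laurent_point_uminus) fact
  let ?p = "laurent_eval \<xi> \<eta> [:a, b:]" and ?m = "laurent_eval \<xi> (- \<eta>) [:a, b:]"
  have half: "fls_subdegree (fls_const (1/2) * f) = fls_subdegree f" for f :: "'a alg_closure fls"
    by (cases "f = 0") simp_all
  have 2: "fls_const (1/2) * (f + f) = f" for f :: "'a alg_closure fls"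
  proof -
    have "fls_const (1/2) * (f + f) = (fls_const (1/2) + fls_const (1/2)) * f" by (simp add: algebra_simps)
    also have "fls_const (1/2) + fls_const (1/2) = (1 :: 'a alg_closure fls)"
      unfolding fls_plus_const by simp
    finally show ?thesis by simp
  qed
  have "p.at_x a = fls_const (1/2) * (?p + ?m)"
    unfolding p.at_linear m.at_linear using 2[of "p.at_x a"] by simp
  thus "k \<le> fls_subdegree (p.at_x a)" using assms by (simp only: half fls_subdegree_add_ge)
  have "p.at_x b * \<eta> = fls_const (1/2) * (?p + - ?m)"
    unfolding p.at_linear m.at_linear using 2[of "p.at_x b * \<eta>"] by auto
  thus "k \<le> fls_subdegree (p.at_x b * \<eta>)" using assms
    by (simp only: half fls_subdegree_add_ge fls_uminus_subdegree)
qed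

text \<open>The parameter \<open>x - x\<^sub>1 = t\<^sup>e\<close> has \<open>e = 2\<close> exactly at the ramification points of the double cover.\<close>

lemma finite_laurent_point:
  obtains e \<eta> where "e > 0" "laurent_point d g (finite_param x e) \<eta>"
    "laurent_place P (finite_param x e) \<eta> \<in> places L geom_constants"
    "laurent_place P (finite_param x e) (- \<eta>) \<in> places L geom_constants"
    "fls_subdegree \<eta> < int e"
proof -
  define e :: nat where "e = (if order x G = 0 then 1 else 2)"
  have "order x G \<le> 1" using squarefree[of x] by (simp add: G_def)
  hence e: "e = 1 \<and> order x G = 0 \<or> e = 2 \<and> order x G = 1" by (auto simp: e_def)
  hence e0: "e > 0" by auto
  let ?\<xi> = "finite_param x e"
  have inj: "inj_idom_hom (fls_eval ?\<xi>)"
    by (intro inj_idom_hom_fls_eval fls_eval_finite_param(1) e0)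
  have sG: "fls_subdegree (fls_eval ?\<xi> G) = int e * int (order x G)"
    by (rule fls_eval_finite_param(2)[OF e0 G_nonzero])
  \<comment> \<open>Either e = 1 and \<eta> has order 0, or e = 2 and \<eta> has order 1. This gives
    the odd order needed in the ramified case and also the bound by e.\<close>
  obtain \<eta> where \<eta>: "laurent_point d g ?\<xi> \<eta>" "2 * fls_subdegree \<eta> = int e * int (order x G)"
    using exists_sqrt_over[OF inj] sG e by (metis even_mult_iff even_zero mult_zero_right of_nat_0 of_nat_numeral even_numeral)
  interpret p: laurent_point d g ?\<xi> \<eta> by fact
  interpret m: laurent_point d g ?\<xi> "- \<eta>" by (rule laurent_point_uminus) fact
  have "order x [:-x, 1:] = 1" using order_power_n_n[of x 1] by simp
  hence "fls_subdegree (p.at_x (to_fract [:-x, 1:])) = int e"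
    using fls_eval_finite_param(2)[OF e0, of "[:-x, 1:]" x] by (simp add: p.at_x_to_fract)
  hence *: "fls_subdegree (p.at_x (to_fract [:-x, 1:])) = 1 \<or>
      odd (fls_subdegree \<eta>) \<and> fls_subdegree (p.at_x (to_fract [:-x, 1:])) = 2"
    using e \<eta>(2) by auto
  show thesis
  proof (rule that[OF e0 \<eta>(1)])
    show "laurent_place P ?\<xi> \<eta> \<in> places L geom_constants"
      by (rule p.laurent_place_in_places[of "to_fract [:-x, 1:]"]) (use * in blast)
    show "laurent_place P ?\<xi> (- \<eta>) \<in> places L geom_constants"
      by (rule m.laurent_place_in_places[of "to_fract [:-x, 1:]"]) (use * in auto)
    show "fls_subdegree \<eta> < int e" using e \<eta>(2) by auto
  qed
qed

text \<open>The parameter is x = t^(-e). For even degree of \<open>g\<close> the two points at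
  infinity are unramified and e = 1; for odd degree there is a single ramified one, e = 2, and
  \<eta> has the odd order - \<open>degree g\<close>.\<close>

lemma infinite_laurent_point:
  obtains e \<xi> \<eta> where "e > 0" "fls_subdegree \<xi> = - int e" "laurent_point d g \<xi> \<eta>"
    "laurent_place P \<xi> \<eta> \<in> places L geom_constants" "laurent_place P \<xi> (- \<eta>) \<in> places L geom_constants"
    "2 * fls_subdegree \<eta> = - int e * int (degree g)"
proof -
  define e :: nat where "e = (if even (degree g) then 1 else 2)"
  have e: "e = 1 \<and> even (degree g) \<or> e = 2 \<and> odd (degree g)" by (auto simp: e_def)
  hence e0: "e > 0" by auto
  define \<xi> :: "'a alg_closure fls" where "\<xi> = fls_X_inv ^ e"
  have s\<xi>: "fls_subdegree \<xi> = - int e" by (simp add: \<xi>_def)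
  have neg: "fls_subdegree \<xi> < 0" using s\<xi> e0 by simp
  have inj: "inj_idom_hom (fls_eval \<xi>)"
    by (intro inj_idom_hom_fls_eval) (use fls_eval_pole[OF neg] in blast)
  have sG: "fls_subdegree (fls_eval \<xi> G) = - int e * int (degree g)"
    using fls_eval_pole[OF neg G_nonzero] by (simp add: s\<xi> degree_G)
  have "even (fls_subdegree (fls_eval \<xi> G))" unfolding sG using e by auto
  then obtain \<eta> where \<eta>: "laurent_point d g \<xi> \<eta>" "2 * fls_subdegree \<eta> = - int e * int (degree g)"
    using exists_sqrt_over[OF inj] sG by metis
  interpret p: laurent_point d g \<xi> \<eta> by fact
  interpret m: laurent_point d g \<xi> "- \<eta>" by (rule laurent_point_uminus) fact
  have "fls_subdegree (p.at_x (to_fract [:0, 1:])) = - int e"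
    using s\<xi> by (simp add: p.at_x_to_fract fls_eval_pCons)
  hence *: "fls_subdegree (p.at_x (to_fract [:0, 1:])) = -1 \<or>
      odd (fls_subdegree \<eta>) \<and> fls_subdegree (p.at_x (to_fract [:0, 1:])) = -2"
    using e \<eta>(2) by auto
  show thesis
  proof (rule that[OF e0 s\<xi> \<eta>(1) _ _ \<eta>(2)])
    show "laurent_place P \<xi> \<eta> \<in> places L geom_constants"
      by (rule p.laurent_place_in_places[of "to_fract [:0, 1:]"]) (use * in blast)
    show "laurent_place P \<xi> (- \<eta>) \<in> places L geom_constants"
      by (rule m.laurent_place_in_places[of "to_fract [:0, 1:]"]) (use * in auto)
  qed
qed

end

section \<open>Multiples of the difference of two conjugate points\<close>

text \<open>\<open>S\<close> is the expansion of y in powers of \<open>x - x\<^sub>0\<close>. Its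
  nonzero constant term keeps the point away from the ramification, so \<open>x - x\<^sub>0\<close>
  is a local parameter at the point and at its conjugate.\<close>

locale hyperelliptic_point = hyperelliptic_curve +
  fixes x\<^sub>0 :: "'a alg_closure" and S :: "'a alg_closure fps"
  assumes S_square: "fps_const \<delta> * (S * S) = fps_of_poly (pcompose G [:x\<^sub>0, 1:])" and S_0: "S $ 0 \<noteq> 0"
begin

definition "\<xi>\<^sub>0 = finite_param x\<^sub>0 1"
abbreviation "\<eta>\<^sub>0 \<equiv> fps_to_fls S"

definition "P_plus = laurent_place P \<xi>\<^sub>0 \<eta>\<^sub>0"
definition "P_minus = laurent_place P \<xi>\<^sub>0 (- \<eta>\<^sub>0)"

lemma laurent_point_\<eta>\<^sub>0: "laurent_point d g \<xi>\<^sub>0 \<eta>\<^sub>0"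
proof (intro laurent_point.intro laurent_point_axioms.intro hyperelliptic_curve_axioms)
  show "inj_idom_hom (fls_eval \<xi>\<^sub>0)"
    unfolding \<xi>\<^sub>0_def by (intro inj_idom_hom_fls_eval fls_eval_finite_param(1)) simp
  show "fls_const \<delta> * (\<eta>\<^sub>0 * \<eta>\<^sub>0) = fls_eval \<xi>\<^sub>0 G"
    unfolding \<xi>\<^sub>0_def fls_eval_finite_param_1 S_square[symmetric] by (simp add: fls_times_fps_to_fls)
qed

sublocale p: laurent_point d g \<xi>\<^sub>0 \<eta>\<^sub>0 by (rule laurent_point_\<eta>\<^sub>0)
sublocale m: laurent_point d g \<xi>\<^sub>0 "- \<eta>\<^sub>0" by (rule laurent_point_uminus[OF laurent_point_\<eta>\<^sub>0])

lemma subdegree_at_x_linear: "fls_subdegree (p.at_x (to_fract [:-x\<^sub>0, 1:])) = 1"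
  using fls_eval_finite_param(2)[of 1 "[:-x\<^sub>0, 1:]" x\<^sub>0, folded \<xi>\<^sub>0_def] order_power_n_n[of x\<^sub>0 1]
  by (simp add: p.at_x_to_fract)

lemma P_plus_in_places: "P_plus \<in> places L geom_constants"
  and P_minus_in_places: "P_minus \<in> places L geom_constants"
  using subdegree_at_x_linear p.laurent_place_in_places[of "to_fract [:-x\<^sub>0, 1:]"]
    m.laurent_place_in_places[of "to_fract [:-x\<^sub>0, 1:]"]
  by (auto simp: P_plus_def P_minus_def)

text \<open>The function y - y(Q) vanishes at Q but takes the value -2 y(Q), which is not zero, at
  the conjugate point.\<close>

lemma P_plus_neq_P_minus: "P_plus \<noteq> P_minus"
proof
  assume eq: "P_plus = P_minus"
  define y where "y = S $ 0"
  define h where "h = [:- to_fract [:y:], 1:]"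
  have h: "h \<in> carrier L - {0}" by (simp add: h_def)
  have c: "p.at_x (- to_fract [:y:]) = - fls_const y"
    by (simp add: p.x.hom_uminus p.at_x_to_fract fls_eval_pCons)
  have "p.at_xy h = fps_to_fls (S - fps_const y)" "m.at_xy h = fps_to_fls (- S - fps_const y)"
    unfolding h_def p.at_linear m.at_linear c by simp_all
  moreover have "(S - fps_const y) \<noteq> 0" using p.at_nonzero[OF h] calculation by auto
  hence "subdegree (S - fps_const y) > 0" by (auto simp: subdegree_eq_0_iff y_def intro!: Nat.gr0I)
  moreover have "(- S - fps_const y) $ 0 \<noteq> 0" using S_0 by (simp add: y_def)
  hence "subdegree (- S - fps_const y) = 0" by (simp only: subdegree_eq_0_iff) simp
  ultimately have "P_plus h \<noteq> P_minus h" using h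
    by (simp add: P_plus_def P_minus_def laurent_place_def fls_subdegree_fls_to_fps del: fps_to_fls_minus)
  thus False using eq by simp
qed

lemma laurent_place_neq_P:
  assumes "laurent_point d g \<xi> \<eta>" "fls_subdegree (fls_eval \<xi> [:-x\<^sub>0, 1:]) \<noteq> 1"
  shows "laurent_place P \<xi> \<eta> \<noteq> P_plus" "laurent_place P \<xi> \<eta> \<noteq> P_minus"
proof -
  interpret q: laurent_point d g \<xi> \<eta> by fact
  let ?h = "[:to_fract [:-x\<^sub>0, 1:]:]"
  have h: "?h \<in> carrier L - {0}" by simp
  have "laurent_place P \<xi> \<eta> ?h \<noteq> 1"
    using assms(2) h by (simp add: laurent_place_def q.at_pCons q.at_x_to_fract)
  moreover have "P_plus ?h = 1" "P_minus ?h = 1"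
    using subdegree_at_x_linear h by (simp_all add: P_plus_def P_minus_def laurent_place_def p.at_pCons m.at_pCons)
  ultimately show "laurent_place P \<xi> \<eta> \<noteq> P_plus" "laurent_place P \<xi> \<eta> \<noteq> P_minus" by metis+
qed

text \<open>\<open>l ^ n\<close> vanishes to order n at both conjugate points. Its product with
  \<open>h\<close> therefore has no pole at finite distance and vanishes to order 2n at Q;
  regularity at both members of each conjugate pair makes the coefficients \<open>a'\<close> and
  \<open>b'\<close> polynomials, and the order at infinity bounds their degrees.\<close>

lemma principal_imp_pade_degenerate:
  assumes h: "h \<in> carrier L - {0}"
    and val: "\<And>v. v \<in> places L geom_constants \<Longrightarrow>
      v h = (if v = P_plus then int n else if v = P_minus then - int n else 0)"
  shows "pade_degenerate S n"
proof -
  obtain a b where ab: "h = [:a, b:]" using h linear_poly_exhaust[of h] by auto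
  define l where "l = [:-x\<^sub>0, 1:]"
  define a' where "a' = a * to_fract (l ^ n)"
  define b' where "b' = b * to_fract (l ^ n)"
  have [simp]: "l \<noteq> 0" by (simp add: l_def)
  have ord0: "order x\<^sub>0 l = 1" unfolding l_def using order_power_n_n[of x\<^sub>0 1] by simp
  have ord: "order x l = 0" if "x \<noteq> x\<^sub>0" for x unfolding l_def using that by (intro order_0I) simp
  have shift: "fls_subdegree (fract_ext (fls_eval \<xi>) (r * to_fract (l ^ n)))
      = fls_subdegree (fract_ext (fls_eval \<xi>) r) + int n * fls_subdegree (fls_eval \<xi> l)"
    if lp: "laurent_point d g \<xi> \<eta>" and "r \<noteq> 0" for \<xi> \<eta> r
  proof -
    interpret q: laurent_point d g \<xi> \<eta> by fact
    interpret e: inj_idom_hom "fls_eval \<xi>" by (rule q.inj)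
    show ?thesis using that(2) by (simp add: q.x.hom_mult q.at_x_to_fract e.hom_power)
  qed
  interpret e0: comm_ring_hom "fls_eval \<xi>\<^sub>0" by (rule comm_ring_hom_fls_eval)
  have lx0: "fls_subdegree (fls_eval \<xi>\<^sub>0 l) = 1" using subdegree_at_x_linear by (simp add: l_def p.at_x_to_fract)
  have sp: "fls_subdegree (p.at_xy h) = int n" "fls_subdegree (m.at_xy h) = - int n"
    using val[OF P_plus_in_places] val[OF P_minus_in_places] P_plus_neq_P_minus h
    by (auto simp: P_plus_def P_minus_def laurent_place_def split: if_splits)
  have \<eta>0: "\<eta>\<^sub>0 \<noteq> 0" "fls_subdegree \<eta>\<^sub>0 = 0" using S_0 by (auto simp: fls_subdegree_fls_to_fps)
  have b0: "- int n \<le> fls_subdegree (p.at_x a)" "- int n \<le> fls_subdegree (p.at_x b * \<eta>\<^sub>0)"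
    using laurent_point_bounds[OF laurent_point_\<eta>\<^sub>0, of "- int n" a b] sp unfolding ab by auto
  \<comment> \<open>Away from the two points \<open>h\<close> has value 0 at both conjugate places,
    so a and b \<eta> are regular there.\<close>
  have other: "0 \<le> fls_subdegree (fract_ext (fls_eval \<xi>) a)" "0 \<le> fls_subdegree (fract_ext (fls_eval \<xi>) b * \<eta>)"
    if lp: "laurent_point d g \<xi> \<eta>" and pl: "laurent_place P \<xi> \<eta> \<in> places L geom_constants"
      "laurent_place P \<xi> (- \<eta>) \<in> places L geom_constants" and ne: "fls_subdegree (fls_eval \<xi> l) \<noteq> 1" for \<xi> \<eta>
  proof -
    have "laurent_place P \<xi> \<eta> h = 0" "laurent_place P \<xi> (- \<eta>) h = 0"
      using val[OF pl(1)] val[OF pl(2)] laurent_place_neq_P[OF lp] laurent_place_neq_P[OF laurent_point_uminus[OF lp]] ne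
      by (auto simp: l_def)
    hence "0 \<le> fls_subdegree (laurent_eval \<xi> \<eta> [:a, b:])" "0 \<le> fls_subdegree (laurent_eval \<xi> (- \<eta>) [:a, b:])"
      using h by (simp_all add: laurent_place_def ab)
    thus "0 \<le> fls_subdegree (fract_ext (fls_eval \<xi>) a)" "0 \<le> fls_subdegree (fract_ext (fls_eval \<xi>) b * \<eta>)"
      by (rule laurent_point_bounds[OF lp order_refl])+
  qed
  have reg: "\<exists>e>0. fls_subdegree (fract_ext (fls_eval (finite_param x e)) a') > - int e \<and>
      fls_subdegree (fract_ext (fls_eval (finite_param x e)) b') > - int e" for x
  proof (cases "x = x\<^sub>0")
    case True
    have "fls_subdegree (p.at_x a') > -1"
      using b0(1) shift[OF laurent_point_\<eta>\<^sub>0, of a] lx0 by (cases "a = 0") (auto simp: a'_def)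
    moreover have "fls_subdegree (p.at_x b') > -1"
      using b0(2) shift[OF laurent_point_\<eta>\<^sub>0, of b] lx0 \<eta>0 by (cases "b = 0") (auto simp: b'_def)
    ultimately show ?thesis using True unfolding \<xi>\<^sub>0_def by (intro exI[of _ 1]) simp
  next
    case False
    obtain e \<eta> where e: "e > 0" and lp: "laurent_point d g (finite_param x e) \<eta>"
      and pl: "laurent_place P (finite_param x e) \<eta> \<in> places L geom_constants"
        "laurent_place P (finite_param x e) (- \<eta>) \<in> places L geom_constants"
      and s\<eta>: "fls_subdegree \<eta> < int e"
      by (rule finite_laurent_point)
    interpret q: laurent_point d g "finite_param x e" \<eta> by fact
    have l0: "fls_subdegree (fls_eval (finite_param x e) l) = 0"
      using fls_eval_finite_param(2)[OF e, of l x] ord[OF False] by simp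
    hence "fls_subdegree (fls_eval (finite_param x e) l) \<noteq> 1" by simp
    note o = other[OF lp pl this]
    have "\<eta> \<noteq> 0" using q.on_curve fls_eval_finite_param(1)[OF e G_nonzero, of x] by auto
    have "fls_subdegree (q.at_x a') > - int e"
      using o(1) shift[OF lp, of a] l0 e by (cases "a = 0") (auto simp: a'_def)
    \<comment> \<open>Only b \<eta> is known to be regular; as \<eta> has order less than e, the
      order of b still exceeds -e, which is all that \<open>fract_regular_imp_poly\<close> asks
      for.\<close>
    moreover have "fls_subdegree (q.at_x b') > - int e"
      using o(2) shift[OF lp, of b] l0 e s\<eta> \<open>\<eta> \<noteq> 0\<close> by (cases "b = 0") (auto simp: b'_def)
    ultimately show ?thesis using e by blast
  qed
  obtain A where A: "a' = to_fract A" by (rule fract_regular_imp_poly[of a']) (use reg in blast)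
  obtain B where B: "b' = to_fract B" by (rule fract_regular_imp_poly[of b']) (use reg in blast)
  obtain e \<xi> \<eta> where e: "e > 0" and s\<xi>: "fls_subdegree \<xi> = - int e" and lp: "laurent_point d g \<xi> \<eta>"
    and pl: "laurent_place P \<xi> \<eta> \<in> places L geom_constants" "laurent_place P \<xi> (- \<eta>) \<in> places L geom_constants"
    and s\<eta>: "2 * fls_subdegree \<eta> = - int e * int (degree g)"
    by (rule infinite_laurent_point)
  interpret q: laurent_point d g \<xi> \<eta> by fact
  have neg: "fls_subdegree \<xi> < 0" using s\<xi> e by simp
  have pole: "fls_subdegree (fls_eval \<xi> p) = - int e * int (degree p)" if "p \<noteq> 0" for p
    using fls_eval_pole[OF neg that] s\<xi> by simp
  have ll: "fls_subdegree (fls_eval \<xi> l) = - int e" using pole[of l] by (simp add: l_def)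
  hence "fls_subdegree (fls_eval \<xi> l) \<noteq> 1" using e by simp
  note o = other[OF lp pl this]
  have dA: "degree A \<le> n"
  proof (cases "A = 0")
    case False
    hence "a \<noteq> 0" using A by (auto simp: a'_def)
    have "- int e * int (degree A) = fls_subdegree (q.at_x a')"
      using pole[OF False] by (simp add: A q.at_x_to_fract)
    also have "\<dots> \<ge> - int e * int n"
      using o(1) shift[OF lp \<open>a \<noteq> 0\<close>] ll by (simp add: a'_def algebra_simps)
    finally show ?thesis using e by (simp add: mult_le_cancel_left)
  qed simp
  have dB: "degree B + 2 \<le> n" if "B \<noteq> 0"
  proof -
    have "b \<noteq> 0" using that B by (auto simp: b'_def)
    have "\<eta> \<noteq> 0" using q.on_curve fls_eval_pole[OF neg G_nonzero] by auto
    have "- int e * int (degree B) = fls_subdegree (q.at_x b')"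
      using pole[OF that] by (simp add: B q.at_x_to_fract)
    also have "\<dots> = fls_subdegree (q.at_x b) - int e * int n"
      using shift[OF lp \<open>b \<noteq> 0\<close>] ll by (simp add: b'_def algebra_simps)
    finally have "int e * int (degree B) = int e * int n - fls_subdegree (q.at_x b)" by simp
    moreover have "fls_subdegree (q.at_x b) \<ge> - fls_subdegree \<eta>"
      using o(2) \<open>b \<noteq> 0\<close> \<open>\<eta> \<noteq> 0\<close> by simp
    moreover have "2 * fls_subdegree \<eta> = - (int e * int (degree g))" using s\<eta> by simp
    ultimately have "2 * (int e * int (degree B)) + int e * int (degree g) \<le> 2 * (int e * int n)" by linarith
    hence "int e * (2 * int (degree B) + int (degree g)) \<le> int e * (2 * int n)" by (simp add: algebra_simps)
    hence "2 * int (degree B) + int (degree g) \<le> 2 * int n" using e by (simp add: mult_le_cancel_left)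
    \<comment> \<open>From 2 deg B + 3 \<le> 2n the parity yields deg B \<le> n - 2.\<close>
    thus ?thesis using degree_ge_3 by linarith
  qed
  define A' where "A' = pcompose A [:x\<^sub>0, 1:]"
  define B' where "B' = pcompose B [:x\<^sub>0, 1:]"
  define F where "F = fps_of_poly A' + fps_of_poly B' * S"
  have "fps_to_fls F = p.at_x a' + p.at_x b' * \<eta>\<^sub>0"
    unfolding A B p.at_x_to_fract unfolding \<xi>\<^sub>0_def fls_eval_finite_param_1 F_def A'_def B'_def
    by (simp add: fls_times_fps_to_fls)
  also have "\<dots> = p.at_x (to_fract (l ^ n)) * p.at_xy h"
    unfolding a'_def b'_def ab p.at_linear p.x.hom_mult by (simp add: algebra_simps)
  also have "p.at_x (to_fract (l ^ n)) = fls_eval \<xi>\<^sub>0 l ^ n"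
    unfolding p.at_x_to_fract by (rule e0.hom_power)
  finally have FF: "fps_to_fls F = fls_eval \<xi>\<^sub>0 l ^ n * p.at_xy h" .
  have nz: "fls_eval \<xi>\<^sub>0 l \<noteq> 0" "p.at_xy h \<noteq> 0" using lx0 p.at_nonzero[OF h] by auto
  have "F \<noteq> 0" using FF nz by auto
  \<comment> \<open>One n comes from \<open>l ^ n\<close>, the other from the zero of
    \<open>h\<close> at Q.\<close>
  have "fls_subdegree (fps_to_fls F) = 2 * int n" unfolding FF using nz lx0 sp by simp
  hence "subdegree F = 2 * n" by (simp add: fls_subdegree_fls_to_fps)
  hence F0: "F $ j = 0" if "j < 2*n" for j using nth_less_subdegree_zero[of j F] that by presburger
  have "A' \<noteq> 0 \<or> B' \<noteq> 0" using \<open>F \<noteq> 0\<close> by (auto simp: F_def)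
  moreover have "degree A' \<le> n" using dA by (simp add: A'_def)
  moreover have "B' = 0 \<or> degree B' + 2 \<le> n" using dB by (cases "B = 0") (simp_all add: B'_def)
  ultimately show ?thesis unfolding pade_degenerate_def using F0[unfolded F_def]
    by (intro exI[of _ A'] exI[of _ B']) blast
qed

end

section \<open>Galois action\<close>

definition map_fls :: "('a::zero \<Rightarrow> 'b::zero) \<Rightarrow> 'a fls \<Rightarrow> 'b fls" where
  "map_fls h f = Abs_fls (\<lambda>n. h (fls_nth f n))"

context field_hom begin

lemma map_fls_nth [simp]: "fls_nth (map_fls hom f) n = hom (fls_nth f n)"
  unfolding map_fls_def by (rule nth_Abs_fls_lower_bound[of "fls_subdegree f"]) simp

lemma map_fls_subdegree [simp]: "fls_subdegree (map_fls hom f) = fls_subdegree f"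
proof (cases "f = 0")
  case True
  hence "map_fls hom f = 0" by (intro fls_eqI) simp
  thus ?thesis using True by simp
qed (auto intro!: fls_subdegree_eqI)

lemma field_hom_map_fls: "field_hom (map_fls hom)"
proof unfold_locales
  fix f g
  show "map_fls hom (f + g) = map_fls hom f + map_fls hom g" by (rule fls_eqI) (simp add: hom_add)
  show "map_fls hom (f * g) = map_fls hom f * map_fls hom g"
    by (rule fls_eqI) (simp add: fls_times_nth(2) hom_sum hom_mult)
qed (auto intro!: fls_eqI)

lemma map_fls_const: "map_fls hom (fls_const c) = fls_const (hom c)"
  by (rule fls_eqI) simp

lemma map_fls_X: "map_fls hom fls_X = fls_X"
  by (rule fls_eqI) simp

lemma map_fls_fps_to_fls: "map_fls hom (fps_to_fls f) = fps_to_fls (map_fps hom f)"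
  by (rule fls_eqI) simp

lemma map_fls_eval: "map_fls hom (fls_eval \<xi> p) = fls_eval (map_fls hom \<xi>) (map_poly hom p)"
proof -
  interpret M: field_hom "map_fls hom" by (rule field_hom_map_fls)
  show ?thesis
    by (induction p) (simp_all add: fls_eval_pCons Polynomial.map_poly_pCons M.hom_add M.hom_mult map_fls_const)
qed

end

lemma absolute_galois_field_hom:
  assumes "\<sigma> \<in> absolute_galois"
  shows "field_hom \<sigma>"
proof -
  have "\<sigma> (to_ac 1) = to_ac 1" and add: "\<And>a b. \<sigma> (a + b) = \<sigma> a + \<sigma> b"
    using assms unfolding absolute_galois_def by blast+
  moreover have "\<sigma> 0 + \<sigma> 0 = \<sigma> 0" using add[of 0 0] by simp
  ultimately show ?thesis using assms
    by unfold_locales (auto simp: absolute_galois_def)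
qed

lemma absolute_galois_inv:
  assumes "\<sigma> \<in> absolute_galois"
  shows "inv_into UNIV \<sigma> \<in> absolute_galois" "inv_into UNIV (inv_into UNIV \<sigma>) = \<sigma>"
    "\<sigma> (inv_into UNIV \<sigma> a) = a" "inv_into UNIV \<sigma> (\<sigma> a) = a" "\<sigma> (to_ac b) = to_ac b"
proof -
  have bij: "bij \<sigma>" using assms by (simp add: absolute_galois_def)
  note inj = bij_is_inj[OF bij] and surj = bij_is_surj[OF bij]
  show sv: "\<sigma> (inv_into UNIV \<sigma> a) = a" for a by (rule surj_f_inv_f[OF surj])
  show vs: "inv_into UNIV \<sigma> (\<sigma> a) = a" for a by (rule inv_f_f[OF inj])
  show "inv_into UNIV (inv_into UNIV \<sigma>) = \<sigma>" by (rule inv_inv_eq[OF bij])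
  show fx: "\<sigma> (to_ac b) = to_ac b" for b using assms by (simp add: absolute_galois_def)
  have add: "\<sigma> (a + b) = \<sigma> a + \<sigma> b" and mult: "\<sigma> (a * b) = \<sigma> a * \<sigma> b" for a b
    using assms by (simp_all add: absolute_galois_def)
  show "inv_into UNIV \<sigma> \<in> absolute_galois" unfolding absolute_galois_def
  proof (intro CollectI conjI allI)
    show "bij (inv_into UNIV \<sigma>)" by (rule bij_imp_bij_inv[OF bij])
    fix a b
    show "inv_into UNIV \<sigma> (a + b) = inv_into UNIV \<sigma> a + inv_into UNIV \<sigma> b"
      using add[of "inv_into UNIV \<sigma> a" "inv_into UNIV \<sigma> b"] by (metis sv vs)
    show "inv_into UNIV \<sigma> (a * b) = inv_into UNIV \<sigma> a * inv_into UNIV \<sigma> b"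
      using mult[of "inv_into UNIV \<sigma> a" "inv_into UNIV \<sigma> b"] by (metis sv vs)
  next
    fix a show "inv_into UNIV \<sigma> (to_ac a) = to_ac a" by (metis fx vs)
  qed
qed

section \<open>Galois action on the function field\<close>

lemma inj_idom_hom_map_poly_to_fract:
  assumes "field_hom \<sigma>"
  shows "inj_idom_hom (\<lambda>p. to_fract (map_poly \<sigma> p))"
proof -
  interpret field_hom \<sigma> by fact
  interpret m: map_poly_inj_idom_hom \<sigma> ..
  show ?thesis by unfold_locales (simp_all add: m.hom_add m.hom_mult)
qed

lemma galois_ratfun_eq_fract_ext:
  assumes "field_hom \<sigma>"
  shows "galois_ratfun \<sigma> = fract_ext (\<lambda>p. to_fract (map_poly \<sigma> p))"
proof
  fix r :: "'a alg_closure poly fract"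
  interpret field_hom \<sigma> by fact
  interpret m: map_poly_inj_idom_hom \<sigma> ..
  have "snd (quot_of_fract r) \<noteq> 0" by simp
  hence "map_poly \<sigma> (snd (quot_of_fract r)) \<noteq> 0" by simp
  thus "galois_ratfun \<sigma> r = fract_ext (\<lambda>p. to_fract (map_poly \<sigma> p)) r"
    by (simp add: galois_ratfun_def fract_ext_def case_prod_unfold Fract_conv_to_fract)
qed

lemma galois_ratfun_Fract:
  assumes "field_hom \<sigma>" "q \<noteq> 0"
  shows "galois_ratfun \<sigma> (Fract p q) = Fract (map_poly \<sigma> p) (map_poly \<sigma> q)"
  unfolding galois_ratfun_eq_fract_ext[OF assms(1)]
    fract_ext_Fract[OF inj_idom_hom_map_poly_to_fract[OF assms(1)] assms(2)]
  by (simp add: Fract_conv_to_fract)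

lemma galois_ratfun_to_fract:
  assumes "field_hom \<sigma>"
  shows "galois_ratfun \<sigma> (to_fract p) = to_fract (map_poly \<sigma> p)"
  unfolding galois_ratfun_eq_fract_ext[OF assms]
  by (rule fract_ext_to_fract[OF inj_idom_hom_map_poly_to_fract[OF assms]])

lemma field_hom_galois_ratfun: "field_hom \<sigma> \<Longrightarrow> field_hom (galois_ratfun \<sigma>)"
  by (simp add: galois_ratfun_eq_fract_ext field_hom_fract_ext inj_idom_hom_map_poly_to_fract)

lemma galois_ratfun_inverse:
  assumes "field_hom \<sigma>" "field_hom \<tau>" "\<And>a. \<sigma> (\<tau> a) = a"
  shows "galois_ratfun \<sigma> (galois_ratfun \<tau> r) = r"
proof -
  interpret t: field_hom \<tau> by fact
  interpret s: field_hom \<sigma> by fact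
  obtain p q where r: "r = Fract p q" "q \<noteq> 0" by (cases r)
  have "map_poly \<sigma> (map_poly \<tau> p) = p" for p
    by (rule poly_eqI) (simp add: coeff_map_poly assms(3))
  moreover have "map_poly \<tau> q \<noteq> 0" using r(2) by simp
  ultimately show ?thesis using r(2) by (simp add: r(1) galois_ratfun_Fract assms(1,2))
qed

context
  fixes \<sigma> :: "'a::field_char_0 alg_closure \<Rightarrow> 'a alg_closure"
  assumes \<sigma>: "\<sigma> \<in> absolute_galois"
begin

interpretation s: field_hom \<sigma> by (rule absolute_galois_field_hom[OF \<sigma>])
interpretation r: field_hom "galois_ratfun \<sigma>" by (rule field_hom_galois_ratfun) (rule s.field_hom_axioms)
interpretation t: field_hom "inv_into UNIV \<sigma>" by (rule absolute_galois_field_hom[OF absolute_galois_inv(1)[OF \<sigma>]])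
interpretation rt: field_hom "galois_ratfun (inv_into UNIV \<sigma>)" by (rule field_hom_galois_ratfun) (rule t.field_hom_axioms)
interpretation m: map_poly_inj_idom_hom "galois_ratfun \<sigma>" ..

lemma galois_fun_degree: "degree (galois_fun \<sigma> h) = degree h"
  by (simp add: galois_fun_def)

lemma galois_fun_eq_0_iff: "galois_fun \<sigma> h = 0 \<longleftrightarrow> h = 0"
  by (simp add: galois_fun_def)

lemma galois_fun_add: "galois_fun \<sigma> (f + h) = galois_fun \<sigma> f + galois_fun \<sigma> h"
  by (simp add: galois_fun_def m.hom_add)

lemma galois_fun_mult_mod:
  "galois_fun \<sigma> ((f * h) mod q) = (galois_fun \<sigma> f * galois_fun \<sigma> h) mod galois_fun \<sigma> q"
  by (simp add: galois_fun_def m.hom_mult r.map_poly_mod)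

lemma galois_fun_inv: "galois_fun \<sigma> (galois_fun (inv_into UNIV \<sigma>) h) = h"
  unfolding galois_fun_def
  by (rule poly_eqI) (simp add: coeff_map_poly galois_ratfun_inverse[OF s.field_hom_axioms t.field_hom_axioms absolute_galois_inv(3)[OF \<sigma>]])

lemma galois_fun_geom_eqn: "galois_fun \<sigma> (geom_eqn P) = geom_eqn P"
proof -
  have "map_poly \<sigma> (map_poly to_ac c) = map_poly to_ac c" for c :: "'a poly"
    by (rule poly_eqI) (simp add: coeff_map_poly absolute_galois_inv(5)[OF \<sigma>])
  thus ?thesis unfolding galois_fun_def geom_eqn_def
    by (intro poly_eqI) (simp add: coeff_map_poly galois_ratfun_to_fract[OF s.field_hom_axioms])
qed

lemma galois_fun_constants: "a \<in> geom_constants \<Longrightarrow> galois_fun \<sigma> a \<in> geom_constants"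
  by (auto simp: geom_constants_def galois_fun_def Polynomial.map_poly_pCons galois_ratfun_to_fract[OF s.field_hom_axioms])

end

section \<open>Galois action on places and divisors\<close>

context hyperelliptic_curve begin

text \<open>The absence of zero divisors is read off from an embedding into Laurent series, here the
  one at infinity.\<close>

lemma mult_in_carrier:
  assumes "f \<in> carrier L - {0}" "h \<in> carrier L - {0}"
  shows "f \<otimes>\<^bsub>L\<^esub> h \<in> carrier L - {0}"
proof -
  obtain \<xi> \<eta> where "laurent_point d g \<xi> \<eta>" using infinite_laurent_point by metis
  then interpret laurent_point d g \<xi> \<eta> .
  show ?thesis using mult_mod_in_carrier[OF assms] by simp
qed

lemma galois_fun_in_carrier:
  assumes "\<rho> \<in> absolute_galois" "h \<in> carrier L - {0}"
  shows "galois_fun \<rho> h \<in> carrier L - {0}"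
  using assms(2) galois_fun_degree[OF assms(1)] galois_fun_eq_0_iff[OF assms(1)] by simp

lemma galois_place_in_places:
  assumes \<sigma>: "\<sigma> \<in> absolute_galois" and v: "v \<in> places L geom_constants"
  shows "galois_place P \<sigma> v \<in> places L geom_constants"
proof -
  define \<tau> where "\<tau> = inv_into UNIV \<sigma>"
  have \<tau>: "\<tau> \<in> absolute_galois" using absolute_galois_inv(1)[OF \<sigma>] by (simp add: \<tau>_def)
  have ts: "galois_fun \<tau> (galois_fun \<sigma> h) = h" for h
    using galois_fun_inv[OF \<tau>] absolute_galois_inv(2)[OF \<sigma>] by (simp add: \<tau>_def)
  note car = galois_fun_in_carrier
  have gp: "galois_place P \<sigma> v h = v (galois_fun \<tau> h)" if "h \<in> carrier L - {0}" for h
    using that by (simp add: galois_place_def \<tau>_def)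
  have v1: "v ` (carrier L - {0}) = UNIV" and v2: "\<And>a. a \<in> geom_constants - {0} \<Longrightarrow> v a = 0"
    and v3: "\<And>f h. f \<in> carrier L - {0} \<Longrightarrow> h \<in> carrier L - {0} \<Longrightarrow> v (f \<otimes>\<^bsub>L\<^esub> h) = v f + v h"
    and v4: "\<And>f h. f \<in> carrier L - {0} \<Longrightarrow> h \<in> carrier L - {0} \<Longrightarrow> f \<oplus>\<^bsub>L\<^esub> h \<noteq> 0 \<Longrightarrow> min (v f) (v h) \<le> v (f \<oplus>\<^bsub>L\<^esub> h)"
    using v unfolding places_def by auto
  show ?thesis unfolding places_def
  proof (intro CollectI conjI ballI impI)
    show "galois_place P \<sigma> v \<in> extensional (carrier L - {\<zero>\<^bsub>L\<^esub>})" by (simp add: galois_place_def)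
    have "k \<in> galois_place P \<sigma> v ` (carrier L - {\<zero>\<^bsub>L\<^esub>})" for k
    proof -
      obtain h where h: "h \<in> carrier L - {0}" "v h = k" using v1 by (metis UNIV_I imageE)
      show ?thesis using car[OF \<sigma> h(1)] h(2) gp[OF car[OF \<sigma> h(1)]]
        by (intro image_eqI[of _ _ "galois_fun \<sigma> h"]) (simp_all add: ts)
    qed
    thus "galois_place P \<sigma> v ` (carrier L - {\<zero>\<^bsub>L\<^esub>}) = UNIV" by blast
    show "galois_place P \<sigma> v a = 0" if "a \<in> geom_constants - {\<zero>\<^bsub>L\<^esub>}" for a
    proof -
      have "a \<in> carrier L - {0}" using that by (auto simp: geom_constants_def)
      thus ?thesis using that galois_fun_constants[OF \<tau>] galois_fun_eq_0_iff[OF \<tau>]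
        by (simp add: gp v2)
    qed
    fix f h assume fh: "f \<in> carrier L - {\<zero>\<^bsub>L\<^esub>}" "h \<in> carrier L - {\<zero>\<^bsub>L\<^esub>}"
    hence fh': "f \<in> carrier L - {0}" "h \<in> carrier L - {0}" by simp_all
    note c = car[OF \<tau> fh'(1)] car[OF \<tau> fh'(2)]
    show "galois_place P \<sigma> v (f \<otimes>\<^bsub>L\<^esub> h) = galois_place P \<sigma> v f + galois_place P \<sigma> v h"
      unfolding gp[OF fh'(1)] gp[OF fh'(2)] gp[OF mult_in_carrier[OF fh']] v3[OF c, symmetric]
      by (simp add: galois_fun_mult_mod[OF \<tau>] galois_fun_geom_eqn[OF \<tau>])
    assume "f \<oplus>\<^bsub>L\<^esub> h \<noteq> \<zero>\<^bsub>L\<^esub>"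
    hence s: "f + h \<in> carrier L - {0}" using fh by (simp add: degree_add_less)
    have "galois_fun \<tau> f \<oplus>\<^bsub>L\<^esub> galois_fun \<tau> h = galois_fun \<tau> (f + h)" by (simp add: galois_fun_add[OF \<tau>])
    moreover have "galois_fun \<tau> (f + h) \<noteq> 0" using car[OF \<tau> s] by simp
    ultimately show "min (galois_place P \<sigma> v f) (galois_place P \<sigma> v h) \<le> galois_place P \<sigma> v (f \<oplus>\<^bsub>L\<^esub> h)"
      using v4[OF c] gp[OF fh'(1)] gp[OF fh'(2)] gp[OF s] by simp
  qed
qed

lemma galois_place_inv:
  assumes \<sigma>: "\<sigma> \<in> absolute_galois" and v: "v \<in> places L geom_constants"
  shows "galois_place P \<sigma> (galois_place P (inv_into UNIV \<sigma>) v) = v"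
proof
  fix h
  note \<tau> = absolute_galois_inv(1)[OF \<sigma>]
  show "galois_place P \<sigma> (galois_place P (inv_into UNIV \<sigma>) v) h = v h"
  proof (cases "h \<in> carrier L - {0}")
    case True
    note c = galois_fun_in_carrier[OF \<tau> True]
    have "galois_place P \<sigma> (galois_place P (inv_into UNIV \<sigma>) v) h
        = v (galois_fun (inv_into UNIV (inv_into UNIV \<sigma>)) (galois_fun (inv_into UNIV \<sigma>) h))"
      using True c unfolding galois_place_def by (simp only: restrict_apply' if_True)
    thus ?thesis by (simp add: absolute_galois_inv(2)[OF \<sigma>] galois_fun_inv[OF \<sigma>])
  next
    case False
    have "v \<in> extensional (carrier L - {0})" using v unfolding places_def by simp
    hence "v h = undefined" using False by (rule extensional_arb)
    thus ?thesis using False unfolding galois_place_def by (simp only: restrict_def if_False)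
  qed
qed

lemma galois_divisor_add:
  "galois_divisor P \<sigma> (c + c') = galois_divisor P \<sigma> c + galois_divisor P \<sigma> c'"
  by (simp add: galois_divisor_def frag_extend_add)

lemma keys_galois_divisor:
  assumes "\<sigma> \<in> absolute_galois" "Poly_Mapping.keys c \<subseteq> places L geom_constants"
  shows "Poly_Mapping.keys (galois_divisor P \<sigma> c) \<subseteq> places L geom_constants"
proof -
  have "Poly_Mapping.keys (galois_divisor P \<sigma> c)
      \<subseteq> (\<Union>v\<in>Poly_Mapping.keys c. Poly_Mapping.keys (frag_of (galois_place P \<sigma> v)))"
    unfolding galois_divisor_def by (rule keys_frag_extend)
  thus ?thesis using assms galois_place_in_places by fastforce
qed

lemma lookup_galois_divisor:
  assumes \<sigma>: "\<sigma> \<in> absolute_galois" and c: "Poly_Mapping.keys c \<subseteq> places L geom_constants"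
    and w: "w \<in> places L geom_constants"
  shows "Poly_Mapping.lookup (galois_divisor P \<sigma> c) w
    = Poly_Mapping.lookup c (galois_place P (inv_into UNIV \<sigma>) w)"
  using c
proof (induction c rule: frag_induction)
  case (one v)
  note \<tau> = absolute_galois_inv(1)[OF \<sigma>]
  have "w = galois_place P \<sigma> v \<longleftrightarrow> galois_place P (inv_into UNIV \<sigma>) w = v"
    using galois_place_inv[OF \<sigma> w] galois_place_inv[OF \<tau> one] absolute_galois_inv(2)[OF \<sigma>] by metis
  thus ?case by (simp add: galois_divisor_def)
next
  case (diff a b)
  thus ?case by (simp add: galois_divisor_def frag_extend_diff lookup_minus)
qed (simp add: galois_divisor_def)

lemma galois_divisor_inv:
  assumes \<sigma>: "\<sigma> \<in> absolute_galois" and c: "Poly_Mapping.keys c \<subseteq> places L geom_constants"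
  shows "galois_divisor P \<sigma> (galois_divisor P (inv_into UNIV \<sigma>) c) = c"
proof (rule poly_mapping_eqI)
  fix w
  note \<tau> = absolute_galois_inv(1)[OF \<sigma>]
  note k = keys_galois_divisor[OF \<tau> c]
  show "Poly_Mapping.lookup (galois_divisor P \<sigma> (galois_divisor P (inv_into UNIV \<sigma>) c)) w = Poly_Mapping.lookup c w"
  proof (cases "w \<in> places L geom_constants")
    case True
    show ?thesis
      unfolding lookup_galois_divisor[OF \<sigma> k True]
        lookup_galois_divisor[OF \<tau> c galois_place_in_places[OF \<tau> True]]
      by (simp add: absolute_galois_inv(2)[OF \<sigma>] galois_place_inv[OF \<sigma> True])
  next
    case False
    hence "w \<notin> Poly_Mapping.keys c" "w \<notin> Poly_Mapping.keys (galois_divisor P \<sigma> (galois_divisor P (inv_into UNIV \<sigma>) c))"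
      using c keys_galois_divisor[OF \<sigma> k] by blast+
    thus ?thesis unfolding in_keys_iff by linarith
  qed
qed

section \<open>Principal divisors and the powers of their cosets\<close>

abbreviation "H \<equiv> principal_divisors L geom_constants"

lemma H_keys: "c \<in> H \<Longrightarrow> Poly_Mapping.keys c \<subseteq> places L geom_constants"
  by (simp add: principal_divisors_def free_Abelian_group_def)

lemma place_mult:
  assumes "v \<in> places L geom_constants" "f \<in> carrier L - {0}" "h \<in> carrier L - {0}"
  shows "v (f \<otimes>\<^bsub>L\<^esub> h) = v f + v h"
proof -
  have "\<forall>f \<in> carrier L - {\<zero>\<^bsub>L\<^esub>}. \<forall>h \<in> carrier L - {\<zero>\<^bsub>L\<^esub>}. v (f \<otimes>\<^bsub>L\<^esub> h) = v f + v h"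
    using assms(1) unfolding places_def by blast
  thus ?thesis using assms(2,3) by simp
qed

lemma H_0: "0 \<in> H"
proof -
  have "v 1 = 0" if "v \<in> places L geom_constants" for v
  proof -
    \<comment> \<open>The product in \<open>L\<close> is reduced modulo the equation, so this is
      what makes 1 idempotent there; additivity then forces v 1 = 0.\<close>
    have "1 mod geom_eqn P = 1" by (rule mod_poly_less) (simp add: degree_geom_eqn)
    moreover have "v (1 \<otimes>\<^bsub>L\<^esub> 1) = v 1 + v 1" by (intro place_mult that) simp_all
    ultimately show ?thesis by simp
  qed
  thus ?thesis unfolding principal_divisors_def by (auto simp: free_Abelian_group_def intro!: bexI[of _ 1])
qed

lemma H_add:
  assumes "c \<in> H" "c' \<in> H"
  shows "c + c' \<in> H"
proof -
  obtain h where h: "h \<in> carrier L - {0}" "\<And>v. v \<in> places L geom_constants \<Longrightarrow> Poly_Mapping.lookup c v = v h"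
    using assms(1) unfolding principal_divisors_def by auto
  obtain h' where h': "h' \<in> carrier L - {0}" "\<And>v. v \<in> places L geom_constants \<Longrightarrow> Poly_Mapping.lookup c' v = v h'"
    using assms(2) unfolding principal_divisors_def by auto
  have "Poly_Mapping.lookup (c + c') v = v (h \<otimes>\<^bsub>L\<^esub> h')" if "v \<in> places L geom_constants" for v
  proof -
    have "v (h \<otimes>\<^bsub>L\<^esub> h') = v h + v h'" by (rule place_mult[OF that h(1) h'(1)])
    thus ?thesis using h(2)[OF that] h'(2)[OF that] by (simp add: lookup_add)
  qed
  moreover have "Poly_Mapping.keys (c + c') \<subseteq> places L geom_constants"
    using keys_add[of c c'] H_keys[OF assms(1)] H_keys[OF assms(2)] by blast
  ultimately show ?thesis using mult_in_carrier[OF h(1) h'(1)]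
    unfolding principal_divisors_def by (auto simp: free_Abelian_group_def)
qed

text \<open>If \<open>c\<close> is the divisor of h, its image under \<sigma> is the divisor of
  \<open>galois_fun \<sigma> h\<close>.\<close>

lemma galois_divisor_H:
  assumes \<sigma>: "\<sigma> \<in> absolute_galois" and c: "c \<in> H"
  shows "galois_divisor P \<sigma> c \<in> H"
proof -
  note \<tau> = absolute_galois_inv(1)[OF \<sigma>]
  obtain h where h: "h \<in> carrier L - {0}" "\<And>v. v \<in> places L geom_constants \<Longrightarrow> Poly_Mapping.lookup c v = v h"
    using c unfolding principal_divisors_def by auto
  have "Poly_Mapping.lookup (galois_divisor P \<sigma> c) w = w (galois_fun \<sigma> h)" if w: "w \<in> places L geom_constants" for w
  proof -
    have "Poly_Mapping.lookup (galois_divisor P \<sigma> c) w = galois_place P (inv_into UNIV \<sigma>) w h"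
      unfolding lookup_galois_divisor[OF \<sigma> H_keys[OF c] w] by (rule h(2)[OF galois_place_in_places[OF \<tau> w]])
    also have "\<dots> = w (galois_fun \<sigma> h)"
      using h(1) unfolding galois_place_def absolute_galois_inv(2)[OF \<sigma>] by (simp only: restrict_apply' if_True)
    finally show ?thesis .
  qed
  thus ?thesis using galois_fun_in_carrier[OF \<sigma> h(1)] keys_galois_divisor[OF \<sigma> H_keys[OF c]]
    unfolding principal_divisors_def by (auto simp: free_Abelian_group_def)
qed

text \<open>
  The power is computed with \<open>0 \<in> H\<close> and \<open>H + H \<subseteq> H\<close> alone, so the fact that principal divisors have
  degree zero is not needed to test whether it is trivial.
\<close>

lemma H_coset_pow:
  "(\<Union>h\<in>H. {h + c}) [^]\<^bsub>jacobian_points P\<^esub> (n::nat) = (\<Union>h\<in>H. {h + frag_cmul (int n) c})"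
proof (induction n)
  case 0
  show ?case by (auto simp: jacobian_points_def Pic0_def FactGroup_def nat_pow_def)
next
  case (Suc n)
  have "(\<Union>h\<in>H. {h + c}) [^]\<^bsub>jacobian_points P\<^esub> Suc n
      = (\<Union>h\<in>H. {h + frag_cmul (int n) c}) \<otimes>\<^bsub>jacobian_points P\<^esub> (\<Union>h\<in>H. {h + c})"
    by (simp add: Suc nat_pow_def[of _ _ "Suc n"] del: nat_pow_Suc) (simp add: nat_pow_def[symmetric] Suc)
  also have "\<dots> = (\<Union>h\<in>H. \<Union>h'\<in>H. {(h + frag_cmul (int n) c) + (h' + c)})"
    by (auto simp: jacobian_points_def Pic0_def FactGroup_def set_mult_def Div0_def free_Abelian_group_def)
  also have "\<dots> = (\<Union>h\<in>H. {h + frag_cmul (int (Suc n)) c})"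
  proof -
    have eq: "(h + frag_cmul (int n) c) + (h' + c) = (h + h') + frag_cmul (int (Suc n)) c" for h h'
      by (simp add: frag_cmul_distrib algebra_simps)
    have "h + frag_cmul (int (Suc n)) c \<in> (\<Union>h\<in>H. \<Union>h'\<in>H. {(h + h') + frag_cmul (int (Suc n)) c})" if "h \<in> H" for h
      using that H_0 by (intro UN_I[of h] UN_I[of 0]) simp_all
    moreover have "(h + h') + frag_cmul (int (Suc n)) c \<in> (\<Union>h\<in>H. {h + frag_cmul (int (Suc n)) c})" if "h \<in> H" "h' \<in> H" for h h'
      using H_add[OF that] by blast
    ultimately show ?thesis unfolding eq by blast
  qed
  finally show ?case .
qed

end

text \<open>When \<xi> and \<eta> have invariant coefficients, acting on a function acts
  coefficientwise on its expansion, and this does not change the order.\<close>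

lemma (in laurent_point) galois_place_laurent_place:
  assumes \<sigma>: "\<sigma> \<in> absolute_galois" and "map_fls (inv_into UNIV \<sigma>) \<xi> = \<xi>" "map_fls (inv_into UNIV \<sigma>) \<eta> = \<eta>"
  shows "galois_place P \<sigma> (laurent_place P \<xi> \<eta>) = laurent_place P \<xi> \<eta>"
proof
  fix h
  define \<tau> where "\<tau> = inv_into UNIV \<sigma>"
  have \<tau>: "\<tau> \<in> absolute_galois" using absolute_galois_inv(1)[OF \<sigma>] by (simp add: \<tau>_def)
  note fixed = assms(2,3)[folded \<tau>_def]
  interpret t: field_hom \<tau> by (rule absolute_galois_field_hom[OF \<tau>])
  interpret M: field_hom "map_fls \<tau>" by (rule t.field_hom_map_fls)
  interpret r: field_hom "galois_ratfun \<tau>" by (rule field_hom_galois_ratfun) (rule t.field_hom_axioms)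
  have Mx: "map_fls \<tau> (at_x r) = at_x (galois_ratfun \<tau> r)" for r
  proof -
    obtain p q where pq: "r = Fract p q" "q \<noteq> 0" by (cases r)
    have "map_poly \<tau> q \<noteq> 0" using pq(2) by simp
    thus ?thesis using pq(2)
      by (simp add: pq(1) galois_ratfun_Fract[OF t.field_hom_axioms] fract_ext_Fract[OF inj] M.hom_div t.map_fls_eval fixed)
  qed
  show "galois_place P \<sigma> (laurent_place P \<xi> \<eta>) h = laurent_place P \<xi> \<eta> h"
  proof (cases "h \<in> carrier L - {0}")
    case True
    obtain a b where ab: "h = [:a, b:]" using True linear_poly_exhaust[of h] by auto
    have "galois_fun \<tau> h = [:galois_ratfun \<tau> a, galois_ratfun \<tau> b:]"
      unfolding ab galois_fun_def by (simp add: Polynomial.map_poly_pCons)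
    hence "at_xy (galois_fun \<tau> h) = map_fls \<tau> (at_xy h)"
      unfolding ab by (simp add: at_linear M.hom_add M.hom_mult Mx fixed)
    hence "fls_subdegree (at_xy (galois_fun \<tau> h)) = fls_subdegree (at_xy h)" by simp
    thus ?thesis using True galois_fun_in_carrier[OF \<tau> True]
      unfolding galois_place_def laurent_place_def \<tau>_def[symmetric] by (simp only: restrict_apply' if_True)
  next
    case False
    thus ?thesis unfolding galois_place_def laurent_place_def by (simp only: restrict_def if_False)
  qed
qed

context hyperelliptic_point begin

text \<open>A conjugate of \<open>S\<close> has the same square, since the equation and
  \<open>x\<^sub>0\<close> come from the base field, and the same constant term. Hence it equals
  \<open>S\<close>.\<close>

lemma galois_fixes_P:
  assumes \<sigma>: "\<sigma> \<in> absolute_galois" and x: "x\<^sub>0 = to_ac x" and y: "S $ 0 = to_ac y"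
  shows "galois_place P \<sigma> P_plus = P_plus" "galois_place P \<sigma> P_minus = P_minus"
proof -
  define \<tau> where "\<tau> = inv_into UNIV \<sigma>"
  have \<tau>: "\<tau> \<in> absolute_galois" using absolute_galois_inv(1)[OF \<sigma>] by (simp add: \<tau>_def)
  interpret t: field_hom \<tau> by (rule absolute_galois_field_hom[OF \<tau>])
  interpret M: field_hom "map_fls \<tau>" by (rule t.field_hom_map_fls)
  have fx: "\<tau> (to_ac c) = to_ac c" for c by (rule absolute_galois_inv(5)[OF \<tau>])
  have \<xi>: "map_fls \<tau> \<xi>\<^sub>0 = \<xi>\<^sub>0"
    unfolding \<xi>\<^sub>0_def finite_param_def by (simp add: M.hom_add t.map_fls_const t.map_fls_X x fx)
  have mG: "map_poly \<tau> G = G" unfolding G_def by (rule poly_eqI) (simp add: coeff_map_poly fx)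
  have "map_fps \<tau> (fps_const \<delta> * (S * S)) = fps_of_poly (map_poly \<tau> (pcompose G [:x\<^sub>0, 1:]))"
    unfolding S_square by (rule fps_ext) (simp add: coeff_map_poly)
  also have "\<dots> = fps_const \<delta> * (S * S)"
    unfolding t.map_poly_pcompose mG S_square by (simp add: x fx Polynomial.map_poly_pCons)
  also have "map_fps \<tau> (fps_const \<delta> * (S * S)) = map_fps \<tau> (fps_const \<delta>) * (map_fps \<tau> S * map_fps \<tau> S)"
    by (simp add: t.map_fps_mult)
  also have "map_fps \<tau> (fps_const \<delta>) = fps_const \<delta>" by (rule fps_ext) (simp add: \<delta>_def fx)
  finally have "map_fps \<tau> S * map_fps \<tau> S = S * S" by simp
  hence "map_fps \<tau> S = S" by (rule fps_eq_of_square_eq) (use S_0 in \<open>simp_all add: y fx\<close>)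
  hence \<eta>: "map_fls \<tau> \<eta>\<^sub>0 = \<eta>\<^sub>0" by (simp add: t.map_fls_fps_to_fls)
  show "galois_place P \<sigma> P_plus = P_plus" unfolding P_plus_def
    by (rule p.galois_place_laurent_place[OF \<sigma>, folded \<tau>_def, OF \<xi> \<eta>])
  have "map_fls \<tau> (- \<eta>\<^sub>0) = - \<eta>\<^sub>0" using \<eta> by (simp add: M.hom_uminus)
  thus "galois_place P \<sigma> P_minus = P_minus" unfolding P_minus_def
    by (rule m.galois_place_laurent_place[OF \<sigma>, folded \<tau>_def, OF \<xi>])
qed

text \<open>The point of infinite order is the class of Q minus its conjugate. This divisor has
  degree zero and is itself Galois invariant.\<close>

lemma jacobian_positive_rank:
  assumes x: "x\<^sub>0 = to_ac x" and y: "S $ 0 = to_ac y"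
    and nd: "\<And>n. n > 0 \<Longrightarrow> \<not> pade_degenerate S n"
  shows "jacobian_positive_rank P"
proof -
  define c where "c = frag_of P_plus - frag_of P_minus"
  define \<Xi> where "\<Xi> = (\<Union>h\<in>H. {h + c})"
  have look: "Poly_Mapping.lookup c v = (if v = P_plus then 1 else if v = P_minus then -1 else 0)" for v
    using P_plus_neq_P_minus by (simp add: c_def lookup_minus)
  have keys: "Poly_Mapping.keys c = {P_plus, P_minus}"
    by (auto simp: in_keys_iff look split: if_splits)
  have deg: "divisor_degree c = 0"
    unfolding divisor_degree_def keys using P_plus_neq_P_minus by (simp add: look)
  have "c \<in> carrier (Div0 L geom_constants)"
    using deg keys P_plus_in_places P_minus_in_places by (simp add: Div0_def free_Abelian_group_def)
  moreover have "\<Xi> = H #>\<^bsub>Div0 L geom_constants\<^esub> c"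
    by (simp add: \<Xi>_def r_coset_def Div0_def free_Abelian_group_def)
  ultimately have "\<Xi> \<in> carrier (Pic0 L geom_constants)"
    by (auto simp: Pic0_def FactGroup_def RCOSETS_def)
  moreover have "galois_divisor P \<sigma> ` \<Xi> = \<Xi>" if \<sigma>: "\<sigma> \<in> absolute_galois" for \<sigma>
  proof -
    note \<tau> = absolute_galois_inv(1)[OF \<sigma>]
    have fixc: "galois_divisor P \<sigma> c = c"
      unfolding c_def galois_divisor_def using galois_fixes_P[OF \<sigma> x y] by (simp add: frag_extend_diff)
    have eq: "galois_divisor P \<sigma> (h + c) = galois_divisor P \<sigma> h + c" for h
      by (simp add: galois_divisor_add fixc)
    show ?thesis
    proof (intro subset_antisym subsetI)
      fix z assume "z \<in> galois_divisor P \<sigma> ` \<Xi>"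
      then obtain h where "h \<in> H" "z = galois_divisor P \<sigma> (h + c)" by (auto simp: \<Xi>_def)
      thus "z \<in> \<Xi>" using galois_divisor_H[OF \<sigma>, of h] unfolding eq \<Xi>_def by blast
    next
      fix z assume "z \<in> \<Xi>"
      then obtain h where h: "h \<in> H" "z = h + c" by (auto simp: \<Xi>_def)
      define h' where "h' = galois_divisor P (inv_into UNIV \<sigma>) h"
      have "h' \<in> H" unfolding h'_def by (rule galois_divisor_H[OF \<tau> h(1)])
      moreover have "galois_divisor P \<sigma> (h' + c) = z"
        unfolding eq h'_def h(2) galois_divisor_inv[OF \<sigma> H_keys[OF h(1)]] ..
      ultimately show "z \<in> galois_divisor P \<sigma> ` \<Xi>" unfolding \<Xi>_def by blast
    qed
  qed
  ultimately have "\<Xi> \<in> carrier (jacobian_points P)" by (simp add: jacobian_points_def)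
  moreover have "\<Xi> [^]\<^bsub>jacobian_points P\<^esub> n \<noteq> \<one>\<^bsub>jacobian_points P\<^esub>" if "n > 0" for n :: nat
  proof
    assume "\<Xi> [^]\<^bsub>jacobian_points P\<^esub> n = \<one>\<^bsub>jacobian_points P\<^esub>"
    hence "(\<Union>h\<in>H. {h + frag_cmul (int n) c}) = H"
      unfolding \<Xi>_def H_coset_pow by (simp add: jacobian_points_def Pic0_def FactGroup_def)
    \<comment> \<open>If the coset of n c is \<open>H\<close>, then its member 0 + n c is a
      principal divisor.\<close>
    moreover have "0 + frag_cmul (int n) c \<in> (\<Union>h\<in>H. {h + frag_cmul (int n) c})" using H_0 by blast
    ultimately have "frag_cmul (int n) c \<in> H" by simp
    then obtain h where h: "h \<in> carrier L - {0}"
      "\<And>v. v \<in> places L geom_constants \<Longrightarrow> Poly_Mapping.lookup (frag_cmul (int n) c) v = v h"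
      unfolding principal_divisors_def by auto
    have "pade_degenerate S n"
    proof (rule principal_imp_pade_degenerate[OF h(1)])
      fix v assume "v \<in> places L geom_constants"
      thus "v h = (if v = P_plus then int n else if v = P_minus then - int n else 0)"
        using h(2)[of v] by (simp add: look split: if_splits)
    qed
    thus False using nd[OF that] by blast
  qed
  ultimately show ?thesis unfolding jacobian_positive_rank_def by blast
qed

end

section \<open>Transcendental points and twists\<close>

lemma of_rat_unique:
  fixes h :: "rat \<Rightarrow> 'a::field_char_0"
  assumes "comm_ring_hom h"
  shows "h q = of_rat q"
proof -
  interpret comm_ring_hom h by fact
  have int: "h (of_int n) = of_int n" for n by (cases n) (simp_all add: hom_distribs)
  obtain a b where q: "q = Rat.Fract a b" "b > 0" by (cases q)
  have "q * of_int b = of_int a" using q by (simp add: Fract_of_int_quotient)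
  hence "h q * of_int b = of_int a" by (metis hom_mult int)
  moreover have "of_rat q * of_int b = (of_int a :: 'a)" using q by (simp add: of_rat_rat)
  ultimately have "h q * of_int b = of_rat q * of_int b" by simp
  thus ?thesis using q(2) by simp
qed

lemma comm_ring_hom_to_ac: "comm_ring_hom (to_ac :: 'a::field \<Rightarrow> 'a alg_closure)"
  by unfold_locales simp_all

lemma to_ac_of_rat: "to_ac (of_rat q :: 'a::field_char_0) = of_rat q"
proof -
  interpret comm_ring_hom "to_ac :: 'a \<Rightarrow> 'a alg_closure" by (rule comm_ring_hom_to_ac)
  have "comm_ring_hom (\<lambda>q. to_ac (of_rat q :: 'a))"
    by unfold_locales (simp_all add: of_rat_add of_rat_mult)
  thus ?thesis by (rule of_rat_unique)
qed

lemma map_poly_to_ac_of_rat: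
  "map_poly to_ac (map_poly of_rat p :: 'a::field_char_0 poly) = map_poly of_rat p"
  by (rule poly_eqI) (simp add: coeff_map_poly to_ac_of_rat)

lemma poly_map_poly_to_ac: "poly (map_poly to_ac p) (to_ac x) = to_ac (poly p x)"
proof -
  interpret comm_ring_hom "to_ac :: 'a \<Rightarrow> 'a alg_closure" by (rule comm_ring_hom_to_ac)
  show ?thesis by (rule poly_map_poly)
qed

text \<open>Over the rationals the gcd of \<open>p\<close> and its derivative has no complex root,
  so it is a nonzero constant. The resulting Bezout identity excludes common roots in every field of
  characteristic zero.\<close>

lemma rsquarefree_of_rat_transfer:
  fixes p :: "rat poly"
  assumes "rsquarefree (map_poly of_rat p :: complex poly)"
  shows "rsquarefree (map_poly of_rat p :: 'a::field_char_0 poly)"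
proof -
  have root: "poly (map_poly of_rat q) z = 0" if "r dvd q" "poly (map_poly of_rat r) z = 0"
    for q r :: "rat poly" and z :: complex
  proof -
    interpret comm_ring_hom "\<lambda>p. poly (map_poly of_rat p) z" by (rule comm_ring_hom_eval_rat_poly)
    show ?thesis using that by (auto simp: hom_mult)
  qed
  define r where "r = gcd p (pderiv p)"
  have pd: "pderiv (map_poly of_rat p) = (map_poly of_rat (pderiv p) :: 'b::field_char_0 poly)"
    by (rule poly_eqI) (simp add: coeff_pderiv coeff_map_poly of_rat_mult of_rat_add)
  have "p \<noteq> 0" using assms by (auto simp: rsquarefree_def)
  hence "r \<noteq> 0" by (simp add: r_def)
  have "degree r = 0"
  proof (rule ccontr)
    assume "degree r \<noteq> 0"
    hence "degree (map_poly of_rat r :: complex poly) > 0" by simp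
    then obtain z where "poly (map_poly of_rat r) z = (0::complex)"
      using alg_closed_imp_poly_has_root by blast
    hence "poly (map_poly of_rat p) z = 0" "poly (map_poly of_rat (pderiv p)) z = 0"
      using root[of r] by (simp_all add: r_def)
    thus False using assms unfolding rsquarefree_roots pd by blast
  qed
  then obtain c where c: "r = [:c:]" "c \<noteq> 0" using \<open>r \<noteq> 0\<close> by (metis degree_eq_zeroE pCons_0_0)
  obtain s t where st: "s * p + t * pderiv p = r"
    unfolding r_def using bezout_coefficients_fst_snd by blast
  show ?thesis unfolding rsquarefree_roots pd
  proof (intro allI notI)
    fix z :: 'a
    assume z: "poly (map_poly of_rat p) z = 0 \<and> poly (map_poly of_rat (pderiv p)) z = 0"
    interpret comm_ring_hom "\<lambda>p. poly (map_poly of_rat p) z" by (rule comm_ring_hom_eval_rat_poly)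
    have "poly (map_poly of_rat r) z = 0" unfolding st[symmetric] hom_add hom_mult using z by simp
    thus False using c by (simp add: Polynomial.map_poly_pCons)
  qed
qed

text \<open>Over the closure, \<gamma> x as new abscissa turns the right-hand side into the rational
  polynomial \<open>p\<close>, to which the Pade argument applies. The first curve has \<gamma> = 1;
  for the other two \<gamma> is an m-th root of the twisting factor.\<close>

lemma jacobian_positive_rank_isotrivial:
  fixes d x y :: "'a::field_char_0" and g :: "'a poly" and p :: "rat poly" and \<gamma> :: "'a alg_closure"
  assumes "d \<noteq> 0" "degree p \<ge> 3" and sq: "rsquarefree (map_poly of_rat p :: complex poly)"
    and g: "map_poly to_ac g = pcompose (map_poly of_rat p) [:0, \<gamma>:]" and "\<gamma> \<noteq> 0"
    and xy: "d * y ^ 2 = poly g x" and "y \<noteq> 0"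
    and transc: "\<And>q::rat poly. q \<noteq> 0 \<Longrightarrow> poly (map_poly of_rat q) (\<gamma> * to_ac x) \<noteq> 0"
  shows "jacobian_positive_rank (hyperelliptic_eqn d g)"
proof -
  let ?p = "map_poly of_rat p :: 'a alg_closure poly"
  have "degree (map_poly to_ac g) = degree g" by (rule Polynomial.degree_map_poly) simp
  hence dg: "degree g = degree p" unfolding g using \<open>\<gamma> \<noteq> 0\<close> by simp
  have "rsquarefree (map_poly to_ac g)"
  proof -
    have "pderiv (map_poly to_ac g) = smult \<gamma> (pcompose (pderiv ?p) [:0, \<gamma>:])"
      unfolding g by (simp add: pderiv_pcompose pderiv_pCons)
    thus ?thesis using rsquarefree_of_rat_transfer[OF sq, where 'a = "'a alg_closure"] \<open>\<gamma> \<noteq> 0\<close>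
      unfolding rsquarefree_roots g by (auto simp: poly_pcompose)
  qed
  hence ord: "order z (map_poly to_ac g) \<le> 1" for z unfolding rsquarefree_def by (metis le_numeral_extra(4) zero_le_one)
  interpret hyperelliptic_curve d g
    by unfold_locales (use \<open>d \<noteq> 0\<close> \<open>degree p \<ge> 3\<close> dg ord in auto)
  define Q where "Q = pcompose G [:to_ac x, 1:]"
  \<comment> \<open>The constant term of \<open>F\<close> is y^2 by the equation of the curve, so
    the root \<open>S\<close> can be chosen to start with y, which lies in the base field.\<close>
  define F where "F = fps_const (inverse \<delta>) * fps_of_poly Q"
  have "F $ 0 = inverse (to_ac d) * to_ac (poly g x)"
    by (simp add: F_def Q_def G_def \<delta>_def poly_map_poly_to_ac)
  also have "\<dots> = to_ac y ^ 2" unfolding xy[symmetric] using \<open>d \<noteq> 0\<close> by simp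
  finally have F0: "F $ 0 = to_ac y ^ 2" .
  define S where "S = fps_radical (\<lambda>_ _. to_ac y) 2 F"
  have "S ^ 2 = F" using power_radical[of F "\<lambda>_ _. to_ac y" 1] F0 \<open>y \<noteq> 0\<close>
    by (simp add: S_def numeral_2_eq_2)
  hence SS: "S * S = F" by (simp add: power2_eq_square)
  have S0: "S $ 0 = to_ac y" by (simp add: S_def)
  interpret hyperelliptic_point d g "to_ac x" S
  proof unfold_locales
    show "fps_const \<delta> * (S * S) = fps_of_poly (G \<circ>\<^sub>p [:to_ac x, 1:])"
      unfolding SS F_def Q_def by (simp add: mult.assoc[symmetric])
    show "S $ 0 \<noteq> 0" using S0 \<open>y \<noteq> 0\<close> by simp
  qed
  have "degree (map_poly of_rat p :: complex poly) > 0" using \<open>degree p \<ge> 3\<close> by simp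
  then obtain \<alpha> :: complex where \<alpha>: "poly (map_poly of_rat p) \<alpha> = 0"
    using alg_closed_imp_poly_has_root by blast
  hence \<alpha>': "poly (pderiv (map_poly of_rat p)) \<alpha> \<noteq> 0" using sq unfolding rsquarefree_roots by blast
  have "Q = pcompose ?p [:\<gamma> * to_ac x, \<gamma>:]"
    unfolding Q_def G_def g by (simp add: pcompose_assoc[symmetric] pcompose_pCons mult.commute)
  hence "S * S = fps_const (inverse \<delta>) * fps_of_poly (pcompose ?p [:\<gamma> * to_ac x, \<gamma>:])"
    unfolding SS F_def by simp
  hence "\<not> pade_degenerate S n" if "n > 0" for n
    by (intro not_pade_degenerate_sqrt[OF \<alpha> \<alpha>' transc \<open>\<gamma> \<noteq> 0\<close> _ that, where e = "inverse \<delta>"]) simp_all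
  thus ?thesis by (intro jacobian_positive_rank[OF refl S0])
qed


text \<open>\<open>z\<^sup>m\<close> is an eigenvalue of the \<open>m\<close>-th power of the companion matrix of a polynomial with root \<open>z\<close>.\<close>

lemma transcendental_root:
  fixes z :: "'a::field_char_0"
  assumes transc: "\<And>q::rat poly. q \<noteq> 0 \<Longrightarrow> poly (map_poly of_rat q) (z ^ m) \<noteq> 0"
    and "p \<noteq> (0 :: rat poly)"
  shows "poly (map_poly of_rat p) z \<noteq> 0"
proof
  assume pz: "poly (map_poly of_rat p) z = 0"
  define k where "k = degree p"
  have k: "k > 0"
  proof (rule ccontr)
    assume "\<not> k > 0"
    then obtain c where "p = [:c:]" by (metis k_def degree_eq_zeroE neq0_conv)
    thus False using pz assms(2) by (simp add: Polynomial.map_poly_pCons)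
  qed
  define C where "C = mat k k (\<lambda>(i, j). if Suc i < k then (if j = Suc i then 1 else 0) else - coeff p j / coeff p k)"
  define C' :: "'a mat" where "C' = map_mat of_rat C"
  define v where "v = vec k (\<lambda>i. z ^ i)"
  have C: "C \<in> carrier_mat k k" by (simp add: C_def)
  hence C'c: "C' \<in> carrier_mat k k" by (simp add: C'_def)
  have lead: "coeff p k \<noteq> 0" using assms(2) by (simp add: k_def)
  have "v !\<^sub>v 0 \<noteq> 0" using k by (simp add: v_def)
  hence v0: "v \<noteq> 0\<^sub>v k" using k by auto
  have "C' *\<^sub>v v = z \<cdot>\<^sub>v v"
  proof (rule eq_vecI)
    fix i assume "i < dim_vec (z \<cdot>\<^sub>v v)"
    hence i: "i < k" by (simp add: v_def)
    have row: "(C' *\<^sub>v v) !\<^sub>v i = (\<Sum>j=0..<k. of_rat (C $$ (i, j)) * z ^ j)"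
      using i by (simp add: C'_def C_def v_def scalar_prod_def)
    show "(C' *\<^sub>v v) !\<^sub>v i = (z \<cdot>\<^sub>v v) !\<^sub>v i"
    proof (cases "Suc i < k")
      case True
      have "(\<Sum>j=0..<k. of_rat (C $$ (i, j)) * z ^ j) = (\<Sum>j=0..<k. if j = Suc i then z ^ j else 0)"
        using i True by (intro sum.cong) (auto simp: C_def)
      also have "\<dots> = z ^ Suc i" using True by simp
      finally show ?thesis unfolding row using i by (simp add: v_def)
    next
      case False
      hence ik: "Suc i = k" using i by simp
      have "0 = (\<Sum>j\<le>k. of_rat (coeff p j) * z ^ j)"
        using pz by (simp add: poly_altdef k_def coeff_map_poly)
      also have "\<dots> = (\<Sum>j=0..<k. of_rat (coeff p j) * z ^ j) + of_rat (coeff p k) * z ^ k"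
        by (simp add: lessThan_Suc_atMost[symmetric] atLeast0LessThan)
      finally have s: "(\<Sum>j=0..<k. of_rat (coeff p j) * z ^ j) = - of_rat (coeff p k) * z ^ k"
        by (simp add: eq_neg_iff_add_eq_0)
      have "(\<Sum>j=0..<k. of_rat (C $$ (i, j)) * z ^ j)
          = (\<Sum>j=0..<k. - (of_rat (coeff p j) * z ^ j) / of_rat (coeff p k))"
        using i False by (intro sum.cong) (auto simp: C_def of_rat_divide of_rat_minus)
      also have "\<dots> = - (\<Sum>j=0..<k. of_rat (coeff p j) * z ^ j) / of_rat (coeff p k)"
        by (simp add: sum_divide_distrib sum_negf)
      also have "\<dots> = z ^ k" unfolding s using lead by simp
      finally show ?thesis unfolding row using i by (simp add: v_def ik[symmetric])
    qed
  qed (simp add: v_def C'_def C_def)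
  hence ev: "eigenvector C' v z" unfolding eigenvector_def using v0 C'c by (simp add: v_def)
  have pow: "C' ^\<^sub>m m \<in> carrier_mat k k" using C'c by simp
  have "eigenvector (C' ^\<^sub>m m) v (z ^ m)"
    using eigenvector_pow[OF C'c ev, of m] v0 pow C'c unfolding eigenvector_def by (simp add: v_def)
  hence "poly (char_poly (C' ^\<^sub>m m)) (z ^ m) = 0"
    using eigenvalue_root_char_poly[OF pow] unfolding eigenvalue_def by blast
  \<comment> \<open>The power of the companion matrix is rational, so its characteristic polynomial
    is a nonzero rational polynomial with root z^m, against transcendence.\<close>
  moreover have "C' ^\<^sub>m m = map_mat of_rat (C ^\<^sub>m m)" unfolding C'_def by (rule of_rat_hom.mat_hom_pow[OF C, symmetric])
  moreover have Cm: "C ^\<^sub>m m \<in> carrier_mat k k" using C by simp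
  ultimately have "poly (map_poly of_rat (char_poly (C ^\<^sub>m m))) (z ^ m) = 0"
    by (simp add: of_rat_hom.char_poly_hom[OF Cm])
  moreover have "char_poly (C ^\<^sub>m m) \<noteq> 0" using degree_monic_char_poly[OF Cm] by auto
  ultimately show False using transc by blast
qed

section \<open>Transcendental elements of Q(u,v,w) and the two m-twists\<close>

lemma of_rat_ratfun3: "(of_rat q :: ratfun3) = to_fract [:[:[:q:]:]:]"
proof -
  have "comm_ring_hom (\<lambda>q. to_fract [:[:[:q:]:]:] :: ratfun3)"
  proof unfold_locales
    fix a b :: rat
    have "[:[:[:a + b:]:]:] = [:[:[:a:]:]:] + [:[:[:b:]:]:]" "[:[:[:a * b:]:]:] = [:[:[:a:]:]:] * [:[:[:b:]:]:]" by simp_all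
    thus "to_fract [:[:[:a + b:]:]:] = to_fract [:[:[:a:]:]:] + to_fract [:[:[:b:]:]:]"
      "to_fract [:[:[:a * b:]:]:] = to_fract [:[:[:a:]:]:] * to_fract [:[:[:b:]:]:]"
      by (metis to_fract_add, metis to_fract_mult)
  qed (simp_all add: pCons_one)
  thus ?thesis by (rule of_rat_unique[symmetric])
qed

lemma to_fract_power: "to_fract (p ^ n) = to_fract p ^ n"
  by (induction n) simp_all

text \<open>Degrees are taken in the outermost variable. After clearing denominators, the term with
  a^n alone reaches degree n deg a, so nothing can cancel it.\<close>

lemma ratfun3_transcendental:
  fixes a s :: "rat poly poly poly" and q :: "rat poly"
  assumes "degree a > degree s" "s \<noteq> 0" "q \<noteq> 0"
  shows "poly (map_poly of_rat q) (to_fract a / to_fract s :: ratfun3) \<noteq> 0"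
proof
  assume 0: "poly (map_poly of_rat q) (to_fract a / to_fract s :: ratfun3) = 0"
  define n where "n = degree q"
  define T where "T i = smult [:[:coeff q i:]:] (a ^ i * s ^ (n - i))" for i
  define N where "N = (\<Sum>i\<le>n. T i)"
  have a0: "a \<noteq> 0" using assms(1) by auto
  have fs: "to_fract s \<noteq> (0 :: ratfun3)" using assms(2) by simp
  have toT: "(to_fract (T i) :: ratfun3) = to_fract s ^ n * (of_rat (coeff q i) * (to_fract a / to_fract s) ^ i)" if "i \<le> n" for i
  proof -
    have "(to_fract (T i) :: ratfun3) = of_rat (coeff q i) * (to_fract a ^ i * to_fract s ^ (n - i))"
      unfolding T_def of_rat_ratfun3 by (simp flip: to_fract_mult to_fract_power)
    also have "to_fract s ^ (n - i) = (to_fract s ^ n / to_fract s ^ i :: ratfun3)"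
      using that fs by (simp add: power_diff)
    finally show ?thesis by (simp add: power_divide)
  qed
  have "(to_fract N :: ratfun3) = (\<Sum>i\<le>n. to_fract (T i))"
    unfolding N_def by (induction n) simp_all
  also have "\<dots> = to_fract s ^ n * poly (map_poly of_rat q) (to_fract a / to_fract s)"
    unfolding poly_altdef sum_distrib_left
    by (intro sum.cong) (simp_all add: toT n_def coeff_map_poly)
  finally have "N = 0" using 0 by simp
  have "coeff (T i) (n * degree a) = 0" if "i < n" for i
  proof -
    have "degree (T i) \<le> i * degree a + (n - i) * degree s"
    proof -
      have "degree (T i) \<le> degree (a ^ i * s ^ (n - i))" unfolding T_def by (rule degree_smult_le)
      also have "\<dots> \<le> degree (a ^ i) + degree (s ^ (n - i))" by (rule degree_mult_le)
      also have "\<dots> \<le> i * degree a + (n - i) * degree s"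
        by (intro add_mono) (metis degree_power_le mult.commute)+
      finally show ?thesis .
    qed
    also have "\<dots> < i * degree a + (n - i) * degree a" using that assms(1) by simp
    also have "\<dots> = n * degree a" using that by (simp flip: add_mult_distrib)
    finally show ?thesis by (rule coeff_eq_0)
  qed
  hence "coeff N (n * degree a) = coeff (T n) (n * degree a)"
    unfolding N_def coeff_sum lessThan_Suc_atMost[symmetric] by simp
  moreover have "coeff (a ^ n) (n * degree a) = lead_coeff a ^ n"
    using lead_coeff_power[of a n] unfolding degree_power_eq[OF a0] by (simp only: mult.commute)
  hence "coeff (T n) (n * degree a) = [:[:coeff q n:]:] * lead_coeff a ^ n" unfolding T_def by simp
  ultimately have "[:[:coeff q n:]:] * lead_coeff a ^ n = 0" using \<open>N = 0\<close> by (metis coeff_0)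
  thus False using a0 assms(3) by (simp add: n_def)
qed


text \<open>With \<gamma>^m = \<open>D\<close>, the abscissa X = \<gamma> x leads to y^2 = X^m + b.
  The point has X^m = \<open>A\<close>, and X inherits transcendence from its m-th power.\<close>

lemma jacobian_positive_rank_superelliptic_twist:
  fixes D A x y :: ratfun3 and b :: int
  assumes "m \<ge> 3" "b \<noteq> 0" "D \<noteq> 0" "y \<noteq> 0" and A: "D * x ^ m = A" "y ^ 2 = A + of_int b"
    and transc: "\<And>q::rat poly. q \<noteq> 0 \<Longrightarrow> poly (map_poly of_rat q) A \<noteq> 0"
  shows "jacobian_positive_rank (hyperelliptic_eqn 1 (monom D m + [:of_int b:]))"
proof -
  define p :: "rat poly" where "p = monom 1 m + [:of_int b:]"
  have map_p: "map_poly of_rat p = (monom 1 m + [:of_int b:] :: 'b::field_char_0 poly)"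
    unfolding p_def by (rule poly_eqI) (simp add: coeff_map_poly of_rat_add coeff_pCons split: nat.splits)
  have degp: "degree p = m" unfolding p_def using assms(1) by (subst degree_add_eq_left) (simp_all add: degree_monom_eq)
  obtain \<gamma> where \<gamma>: "\<gamma> ^ m = to_ac D" using nth_root_exists[of m "to_ac D"] assms(1) by auto
  have \<gamma>0: "\<gamma> \<noteq> 0" using \<gamma> assms(1,3) by (auto simp: power_0_left)
  show ?thesis
  proof (rule jacobian_positive_rank_isotrivial)
    show "degree p \<ge> 3" using degp assms(1) by simp
    \<comment> \<open>The derivative m X^(m-1) vanishes only at 0, where the polynomial has the
      nonzero value b.\<close>
    show "rsquarefree (map_poly of_rat p :: complex poly)"
      unfolding rsquarefree_roots map_p using assms(1,2)
      by (auto simp: pderiv_add pderiv_monom pderiv_pCons poly_monom power_0_left)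
    have "pcompose (monom 1 m) [:0, \<gamma>:] = monom (\<gamma> ^ m) m"
      by (rule poly_eqI) (simp add: coeff_pcompose_linear)
    thus "map_poly to_ac (monom D m + [:of_int b:]) = pcompose (map_poly of_rat p) [:0, \<gamma>:]"
      unfolding map_p by (intro poly_eqI) (simp add: coeff_map_poly pcompose_add \<gamma> coeff_pCons split: nat.splits)
    show "1 * y ^ 2 = poly (monom D m + [:of_int b:]) x" using A by (simp add: poly_monom)
    have "(\<gamma> * to_ac x) ^ m = to_ac A" by (simp add: power_mult_distrib \<gamma> A(1)[symmetric])
    moreover have "poly (map_poly of_rat q) (to_ac A) \<noteq> 0" if "q \<noteq> 0" for q :: "rat poly"
      using transc[OF that] poly_map_poly_to_ac[of "map_poly of_rat q" A] by (simp add: map_poly_to_ac_of_rat)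
    ultimately show "poly (map_poly of_rat q) (\<gamma> * to_ac x) \<noteq> 0" if "q \<noteq> 0" for q :: "rat poly"
      by (metis transcendental_root that)
  qed (use \<gamma>0 assms in simp_all)
qed

theorem theorem2p1:
  fixes f :: "rat poly" and m :: nat and b c :: int
  assumes "degree f \<ge> 3"
    and "rsquarefree (map_poly of_rat f :: complex poly)"
    and "odd m" and "m \<ge> 3"
    and "b \<noteq> 0" and "c \<noteq> 0"
  shows "\<exists>D :: ratfun3. D \<noteq> 0 \<and>
    jacobian_positive_rank (hyperelliptic_eqn D (map_poly of_rat f)) \<and>
    jacobian_positive_rank (hyperelliptic_eqn 1 (monom D m + [:of_int b:])) \<and>
    jacobian_positive_rank (hyperelliptic_eqn 1 (monom D m + [:of_int c:]))"
proof -
  \<comment> \<open>The outermost of the three variables; everything below lies in the field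
    generated by it.\<close>
  define t :: ratfun3 where "t = to_fract [:0, 1:]"
  define k :: ratfun3 where "k = of_int b - of_int c"
  have t0: "t \<noteq> 0" by (simp add: t_def)
  have t_transc: "poly (map_poly of_rat q) t \<noteq> 0" if "q \<noteq> 0" for q :: "rat poly"
    using ratfun3_transcendental[of 1 "[:0, 1:]" q] that by (simp add: t_def)
  define v where "v = (t + k / t) / 2"
  define w where "w = (k / t - t) / 2"
  define A where "A = v ^ 2 - of_int b"
  have Av: "v ^ 2 = A + of_int b" by (simp add: A_def)
  have Aw: "w ^ 2 = A + of_int c" unfolding A_def v_def w_def using t0
    by (simp add: k_def field_simps power2_eq_square)
  have A_transc: "poly (map_poly of_rat q) A \<noteq> 0" if "q \<noteq> 0" for q :: "rat poly"
  proof -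
    define \<kappa> :: "int \<Rightarrow> rat poly poly" where "\<kappa> n = [:[:of_int n:]:]" for n
    have \<kappa>: "to_fract [:\<kappa> n:] = (of_int n :: ratfun3)" for n
      unfolding \<kappa>_def of_rat_ratfun3[symmetric] by simp
    have pC: "to_fract (pCons r p) = to_fract [:r:] + t * to_fract p" for r and p :: "rat poly poly poly"
    proof -
      have "pCons r p = [:r:] + [:0, 1:] * p" by simp
      thus ?thesis unfolding t_def by (metis to_fract_add to_fract_mult)
    qed
    \<comment> \<open>Expanding v^2 gives 4 t^2 A = t^4 + (2k - 4b) t^2 + k^2, so A is a quotient of
      degrees 4 and 2 in t.\<close>
    define a where "a = [:\<kappa> ((b - c)\<^sup>2), 0, \<kappa> (2 * (b - c) - 4 * b), 0, \<kappa> 1:]"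
    define s where "s = [:0, 0, \<kappa> 4:]"
    have "to_fract a = k ^ 2 + (2 * k - 4 * of_int b) * t ^ 2 + t ^ 4"
      unfolding a_def pC[of _ "pCons _ (pCons _ _)"] pC[of _ "[:_, _:]"] pC[of _ "[:_:]"] \<kappa>
      by (simp add: k_def algebra_simps power2_eq_square power4_eq_xxxx)
    moreover have "to_fract s = 4 * t ^ 2"
      unfolding s_def pC[of _ "pCons _ (pCons _ _)"] pC[of _ "[:_, _:]"] pC[of _ "[:_:]"] \<kappa>
      by (simp add: power2_eq_square)
    ultimately have "A = to_fract a / to_fract s"
      unfolding A_def v_def using t0 by (simp add: field_simps power2_eq_square power4_eq_xxxx)
    moreover have "degree a > degree s" "s \<noteq> 0" by (simp_all add: a_def s_def \<kappa>_def)
    ultimately show ?thesis using ratfun3_transcendental[of s a q] that by simp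
  qed
  define u where "u = poly (map_poly of_rat f) t"
  have "f \<noteq> 0" using assms(1) by auto
  hence u0: "u \<noteq> 0" unfolding u_def by (rule t_transc)
  have A0: "A \<noteq> 0" using A_transc[of "[:0, 1:]"] by (simp add: Polynomial.map_poly_pCons)
  \<comment> \<open>A + n is the value at the transcendental A of X + n. This keeps the ordinates v
    and w away from zero.\<close>
  have ne: "A + of_int n \<noteq> 0" for n
    using A_transc[of "[:of_int n, 1:]"] by (simp add: Polynomial.map_poly_pCons add.commute)
  have v0: "v \<noteq> 0" using Av ne[of b] by auto
  have w0: "w \<noteq> 0" using Aw ne[of c] by auto
  obtain l where m: "m = 2 * l + 1" using assms(3) oddE by blast
  define D where "D = u ^ m * A ^ (m + 1)"
  have D0: "D \<noteq> 0" using u0 A0 by (simp add: D_def)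
  have Dx: "D * (1 / (A * u)) ^ m = A"
    using u0 A0 by (simp add: D_def power_divide power_mult_distrib)
  have "jacobian_positive_rank (hyperelliptic_eqn D (map_poly of_rat f))"
  proof (rule jacobian_positive_rank_isotrivial[OF D0 assms(1,2)])
    show "map_poly to_ac (map_poly of_rat f :: ratfun3 poly) = pcompose (map_poly of_rat f) [:0, 1:]"
      by (simp add: map_poly_to_ac_of_rat)
    \<comment> \<open>Because m = 2l + 1, the exponent m + 1 is 2(l + 1). The inverse of the squared
      factor is the ordinate of the point with abscissa t.\<close>
    have "D = u * (u ^ l * A ^ (l + 1)) ^ 2"
      unfolding D_def m mult_2 power2_eq_square by (simp only: power_add power_one_right mult_ac)
    thus "D * (1 / (u ^ l * A ^ (l + 1))) ^ 2 = poly (map_poly of_rat f) t"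
      using u0 A0 by (simp add: power_divide u_def)
    show "poly (map_poly of_rat q) (1 * to_ac t) \<noteq> 0" if "q \<noteq> 0" for q :: "rat poly"
      using t_transc[OF that] poly_map_poly_to_ac[of "map_poly of_rat q" t] by (simp add: map_poly_to_ac_of_rat)
  qed (use u0 A0 in simp_all)
  moreover have "jacobian_positive_rank (hyperelliptic_eqn 1 (monom D m + [:of_int b:]))"
    by (rule jacobian_positive_rank_superelliptic_twist[OF assms(4,5) D0 v0 Dx Av A_transc])
  moreover have "jacobian_positive_rank (hyperelliptic_eqn 1 (monom D m + [:of_int c:]))"
    by (rule jacobian_positive_rank_superelliptic_twist[OF assms(4,6) D0 w0 Dx Aw A_transc])
  ultimately show ?thesis using D0 by blast
qed

end
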